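(* Put $a=\sqrt{1+\tfrac1{\sqrt2}}$ and $b=\sqrt{1-\tfrac1{\sqrt2}}$. Let $\mathbb E_1^2$ be $\mathbb R^2$ with the metric $dx^2-dy^2$, and let $\mathbb E_4^8$ be $\mathbb R^8$ with the metric $dz_1^2+dz_2^2-dz_3^2-dz_4^2+dz_5^2+dz_6^2-dz_7^2-dz_8^2$. For $c,d>0$ set $$\Theta_{c,d}(x,y)=\bigl(\cos(cx)\cosh(dy),\ \sin(cx)\cosh(dy),\ \sin(cx)\sinh(dy),\ \cos(cx)\sinh(dy)\bigr).$$ Then $$\Phi(x,y)=\frac1{\sqrt2}\bigl(\Theta_{a,b}(x,y),\Theta_{b,a}(x,y)\bigr)$$ defines an isometric immersion $\Phi\colon\mathbb E_1^2\to\mathbb E_4^8$ whose ordinary, spacelike and timelike contact numbers are all equal to six: $\mathfrak c(\mathbb E_1^2)=\mathfrak c_+(\mathbb E_1^2)=\mathfrak c_-(\mathbb E_1^2)=6$.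
   Context: Let $\psi\colon M\to\mathbb E$ be an isometric immersion of a pseudo-Riemannian manifold with indefinite metric into a pseudo-Euclidean space (here $M=\mathbb E_1^2$, $\mathbb E=\mathbb E_4^8$, $\psi=\Phi$). Tangent vectors are identified with their images under $d\psi$, and curves in $M$ with their images under $\psi$. $T_p^\perp M$ denotes the normal space at $p$. Normal sections. For $p\in M$ and $u\in T_pM$ with $\langle u,u\rangle=\varepsilon\in\{1,-1\}$, let $\gamma_u$ be the geodesic of $M$ with $\gamma_u(0)=p$, $\gamma_u'(0)=u$. Let $E(p,u)=\psi(p)+(\mathbb R u\oplus T_p^\perp M)$. Locally, the component through $\psi(p)$ of $\psi(M)\cap E(p,u)$ (where $\psi$ is restricted to a small neighbourhood of $p$) is a regular non-degenerate curve; its unit-speed parametrization $\beta_u$ (i.e. $\langle\beta_u',\beta_u'\rangle=\varepsilon$) with $\beta_u(0)=p$, $\beta_u'(0)=u$ is the normal section at $(p,u)$. Contact. $\gamma_u$ and $\beta_u$ have contact of order $k$ at $(p,u)$ if $\gamma_u^{(r)}(0)=\beta_u^{(r)}(0)$ for all $0\le r\le k$, derivatives being taken in the ambient affine space. The immersion has spacelike (resp. timelike) contact of order $k$ if this holds for every tangent vector $u$ with $\langle u,u\rangle=1$ (resp. $\langle u,u\rangle=-1$), and contact of order $k$ if it has both. The contact numbers $\mathfrak c_+(M)$, $\mathfrak c_-(M)$, $\mathfrak c(M)$ are the suprema of the $k\in\mathbb N$ for which the immersion has, respectively, spacelike contact, timelike contact, contact of order $k$ (value $\infty$ if the set is unbounded).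 *)

theory Defs
  imports "HOL-Analysis.Analysis" "HOL-Library.Extended_Nat"
begin

section \<open>Smoothness\<close>

primrec C_class :: "nat \<Rightarrow> ('a::euclidean_space \<Rightarrow> 'b::euclidean_space) \<Rightarrow> bool" where
  "C_class 0 f \<longleftrightarrow> continuous_on UNIV f"
| "C_class (Suc k) f \<longleftrightarrow> f differentiable_on UNIV \<and>
     (\<forall>v. C_class k (\<lambda>p. frechet_derivative f (at p) v))"

definition smooth_map :: "('a::euclidean_space \<Rightarrow> 'b::euclidean_space) \<Rightarrow> bool" where
  "smooth_map f \<longleftrightarrow> (\<forall>k. C_class k f)"

definition nth_vector_derivative ::
    "nat \<Rightarrow> (real \<Rightarrow> 'a::euclidean_space) \<Rightarrow> real \<Rightarrow> 'a" where
  "nth_vector_derivative r \<gamma> = ((\<lambda>\<delta> t. vector_derivative \<delta> (at t)) ^^ r) \<gamma>"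

definition smooth_curve_on :: "real set \<Rightarrow> (real \<Rightarrow> 'a::euclidean_space) \<Rightarrow> bool" where
  "smooth_curve_on I \<gamma> \<longleftrightarrow>
     (\<forall>r. \<forall>t\<in>I. nth_vector_derivative r \<gamma> differentiable (at t))"


section \<open>Immersions between pseudo-Euclidean spaces\<close>

text \<open>
  A pseudo-Euclidean space is a real vector space together with a constant scalar product,
  passed below as a parameter \<open>g\<close> (on the source \<open>M\<close>) or \<open>h\<close> (on the ambient space).
\<close>

definition isometric_immersion ::
    "('a::euclidean_space \<Rightarrow> 'a \<Rightarrow> real) \<Rightarrow> ('b::euclidean_space \<Rightarrow> 'b \<Rightarrow> real) \<Rightarrow> ('a \<Rightarrow> 'b) \<Rightarrow> bool"
  where
  "isometric_immersion g h \<psi> \<longleftrightarrow> smooth_map \<psi> \<and>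
     (\<forall>p. inj (frechet_derivative \<psi> (at p)) \<and>
        (\<forall>u v. h (frechet_derivative \<psi> (at p) u) (frechet_derivative \<psi> (at p) v) = g u v))"

text \<open>
  The Levi-Civita connection of a constant metric is the flat one, so the covariant
  acceleration of a curve \<open>\<gamma>\<close> in \<open>M\<close> is its second derivative.
\<close>

definition geodesic :: "(real \<Rightarrow> 'a::euclidean_space) \<Rightarrow> bool" where
  "geodesic \<gamma> \<longleftrightarrow> smooth_curve_on UNIV \<gamma> \<and> (\<forall>t. nth_vector_derivative 2 \<gamma> t = 0)"

definition normal_space ::
    "('b::euclidean_space \<Rightarrow> 'b \<Rightarrow> real) \<Rightarrow> ('a::euclidean_space \<Rightarrow> 'b) \<Rightarrow> 'a \<Rightarrow> 'b set" where
  "normal_space h \<psi> p = {w. \<forall>v. h w (frechet_derivative \<psi> (at p) v) = 0}"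

definition section_space ::
    "('b::euclidean_space \<Rightarrow> 'b \<Rightarrow> real) \<Rightarrow> ('a::euclidean_space \<Rightarrow> 'b) \<Rightarrow> 'a \<Rightarrow> 'a \<Rightarrow> 'b set" where
  "section_space h \<psi> p u =
     {\<psi> p + s *\<^sub>R frechet_derivative \<psi> (at p) u + w | s w. w \<in> normal_space h \<psi> p}"


section \<open>Normal sections and contact\<close>

text \<open>
  A normal section matters only as a germ at \<open>0\<close>, so its values outside the interval
  \<open>(-\<delta>, \<delta>)\<close> are arbitrary.  The neighbourhood \<open>U\<close> of \<open>p\<close> is required to be embedded by \<open>\<psi>\<close>:
  \<open>\<psi>\<close> itself may be neither injective nor an embedding, and other sheets of the image
  passing through or accumulating at \<open>\<psi> p\<close> have to be excluded.
\<close>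

definition normal_section ::
    "('a::euclidean_space \<Rightarrow> 'a \<Rightarrow> real) \<Rightarrow> ('b::euclidean_space \<Rightarrow> 'b \<Rightarrow> real) \<Rightarrow> ('a \<Rightarrow> 'b) \<Rightarrow>
     'a \<Rightarrow> 'a \<Rightarrow> (real \<Rightarrow> 'b) \<Rightarrow> bool" where
  "normal_section g h \<psi> p u \<beta> \<longleftrightarrow>
     (\<exists>U \<delta>. open U \<and> p \<in> U \<and> (\<exists>\<phi>. homeomorphism U (\<psi> ` U) \<psi> \<phi>) \<and> \<delta> > 0 \<and>
        smooth_curve_on {-\<delta><..<\<delta>} \<beta> \<and>
        \<beta> ` {-\<delta><..<\<delta>} = connected_component_set (\<psi> ` U \<inter> section_space h \<psi> p u) (\<psi> p) \<and>
        (\<forall>t\<in>{-\<delta><..<\<delta>}.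
           h (vector_derivative \<beta> (at t)) (vector_derivative \<beta> (at t)) = g u u) \<and>
        \<beta> 0 = \<psi> p \<and> vector_derivative \<beta> (at 0) = frechet_derivative \<psi> (at p) u)"

text \<open>
  The geodesic and the germ of the normal section at \<open>(p, u)\<close> are unique; existential
  quantification makes their existence part of the notion of contact.
\<close>

definition contact_at ::
    "('a::euclidean_space \<Rightarrow> 'a \<Rightarrow> real) \<Rightarrow> ('b::euclidean_space \<Rightarrow> 'b \<Rightarrow> real) \<Rightarrow> ('a \<Rightarrow> 'b) \<Rightarrow>
     nat \<Rightarrow> 'a \<Rightarrow> 'a \<Rightarrow> bool" where
  "contact_at g h \<psi> k p u \<longleftrightarrow>
     (\<exists>\<gamma> \<beta>. geodesic \<gamma> \<and> \<gamma> 0 = p \<and> vector_derivative \<gamma> (at 0) = u \<and>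
        normal_section g h \<psi> p u \<beta> \<and>
        (\<forall>r\<le>k. nth_vector_derivative r (\<psi> \<circ> \<gamma>) 0 = nth_vector_derivative r \<beta> 0))"

definition spacelike_contact ::
    "('a::euclidean_space \<Rightarrow> 'a \<Rightarrow> real) \<Rightarrow> ('b::euclidean_space \<Rightarrow> 'b \<Rightarrow> real) \<Rightarrow> ('a \<Rightarrow> 'b) \<Rightarrow>
     nat \<Rightarrow> bool" where
  "spacelike_contact g h \<psi> k \<longleftrightarrow> (\<forall>p u. g u u = 1 \<longrightarrow> contact_at g h \<psi> k p u)"

definition timelike_contact ::
    "('a::euclidean_space \<Rightarrow> 'a \<Rightarrow> real) \<Rightarrow> ('b::euclidean_space \<Rightarrow> 'b \<Rightarrow> real) \<Rightarrow> ('a \<Rightarrow> 'b) \<Rightarrow>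
     nat \<Rightarrow> bool" where
  "timelike_contact g h \<psi> k \<longleftrightarrow> (\<forall>p u. g u u = -1 \<longrightarrow> contact_at g h \<psi> k p u)"

definition contact ::
    "('a::euclidean_space \<Rightarrow> 'a \<Rightarrow> real) \<Rightarrow> ('b::euclidean_space \<Rightarrow> 'b \<Rightarrow> real) \<Rightarrow> ('a \<Rightarrow> 'b) \<Rightarrow>
     nat \<Rightarrow> bool" where
  "contact g h \<psi> k \<longleftrightarrow> spacelike_contact g h \<psi> k \<and> timelike_contact g h \<psi> k"

definition spacelike_contact_number ::
    "('a::euclidean_space \<Rightarrow> 'a \<Rightarrow> real) \<Rightarrow> ('b::euclidean_space \<Rightarrow> 'b \<Rightarrow> real) \<Rightarrow> ('a \<Rightarrow> 'b) \<Rightarrow> enat"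
  where
  "spacelike_contact_number g h \<psi> = Sup {enat k | k. spacelike_contact g h \<psi> k}"

definition timelike_contact_number ::
    "('a::euclidean_space \<Rightarrow> 'a \<Rightarrow> real) \<Rightarrow> ('b::euclidean_space \<Rightarrow> 'b \<Rightarrow> real) \<Rightarrow> ('a \<Rightarrow> 'b) \<Rightarrow> enat"
  where
  "timelike_contact_number g h \<psi> = Sup {enat k | k. timelike_contact g h \<psi> k}"

definition contact_number ::
    "('a::euclidean_space \<Rightarrow> 'a \<Rightarrow> real) \<Rightarrow> ('b::euclidean_space \<Rightarrow> 'b \<Rightarrow> real) \<Rightarrow> ('a \<Rightarrow> 'b) \<Rightarrow> enat"
  where
  "contact_number g h \<psi> = Sup {enat k | k. contact g h \<psi> k}"


section \<open>The flat surface\<close>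

definition metric_E21 :: "real^2 \<Rightarrow> real^2 \<Rightarrow> real" where
  "metric_E21 u v = u$1 * v$1 - u$2 * v$2"

text \<open>In the index type \<open>8\<close> the numeral \<open>8\<close> denotes the same element as \<open>0\<close>.\<close>

definition metric_E84 :: "real^8 \<Rightarrow> real^8 \<Rightarrow> real" where
  "metric_E84 u v =
     u$1 * v$1 + u$2 * v$2 - u$3 * v$3 - u$4 * v$4 +
     u$5 * v$5 + u$6 * v$6 - u$7 * v$7 - u$8 * v$8"

definition Theta :: "real \<Rightarrow> real \<Rightarrow> real^2 \<Rightarrow> real list" where
  "Theta c d p =
     [cos (c * p$1) * cosh (d * p$2), sin (c * p$1) * cosh (d * p$2),
      sin (c * p$1) * sinh (d * p$2), cos (c * p$1) * sinh (d * p$2)]"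

definition Phi :: "real \<Rightarrow> real \<Rightarrow> real^2 \<Rightarrow> real^8" where
  "Phi a b p = (1 / sqrt 2) *\<^sub>R vector (Theta a b p @ Theta b a p)"

end

theory Submission
  imports Defs
begin

text \<open>
  Up to translation, \<open>K(v) = \<langle>\<Phi>(p + v), \<Phi>(p)\<rangle>\<close> does not depend on \<open>p\<close>, and with \<open>u' = (u\<^sub>2, u\<^sub>1) \<bottom> u\<close> the
  image \<open>\<Phi>(p + v)\<close> lies in \<open>E(p, u)\<close> iff the derivative of \<open>K\<close> at \<open>v\<close> in the direction \<open>u'\<close> vanishes. For the
  given \<open>a, b\<close> the terms of \<open>K\<close> of degree 2, 4, 6 are multiples of powers of \<open>\<langle>v, v\<rangle>\<close>, so on the line
  \<open>v = s u\<close> that derivative has order 7 in \<open>s\<close>, with leading coefficient nonzero if \<open>u\<^sub>1 u\<^sub>2 \<noteq> 0\<close>.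

  Hence contact of order 7 fails: pairing \<open>\<beta>\<close> with \<open>d\<Phi>(u')\<close> gives a constant, and pairing
  the geodesic with it gives a function of nonzero seventh derivative. Conversely, in coordinates
  \<open>v = s u + w u'\<close> the implicit function theorem makes the section a graph with \<open>w = O(s\<^sup>7)\<close>;
  parametrized by arc length it satisfies \<open>s - t = O(t\<^sup>7)\<close> and \<open>w = O(t\<^sup>7)\<close>.
  It is smooth since its coordinates satisfy a system of differential equations whose right-hand side
  lies in an algebra of functions closed under derivation.
\<close>

subsection \<open>Derivative sequences of curves\<close>

text \<open>A witness for smoothness on \<open>I\<close>: the derivatives of all orders are carried
  along as explicit functions, so that sums, linear images and closed forms can be handled order by
  order.\<close>

definition deriv_seq :: "real set \<Rightarrow> (nat \<Rightarrow> real \<Rightarrow> 'a::euclidean_space) \<Rightarrow> bool" where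
  "deriv_seq I D \<longleftrightarrow> (\<forall>r. \<forall>t\<in>I. (D r has_vector_derivative D (Suc r) t) (at t))"

lemma deriv_seqD:
  "deriv_seq I D \<Longrightarrow> t \<in> I \<Longrightarrow> (D r has_vector_derivative D (Suc r) t) (at t)"
  by (simp add: deriv_seq_def)

lemma deriv_seq_subset: "deriv_seq J D \<Longrightarrow> I \<subseteq> J \<Longrightarrow> deriv_seq I D"
  by (auto simp: deriv_seq_def)

lemma deriv_seq_diff:
  "deriv_seq I D \<Longrightarrow> deriv_seq I D' \<Longrightarrow> deriv_seq I (\<lambda>r t. D r t - D' r t)"
  by (auto simp: deriv_seq_def intro: has_vector_derivative_diff)

lemma deriv_seq_add:
  "deriv_seq I D \<Longrightarrow> deriv_seq I D' \<Longrightarrow> deriv_seq I (\<lambda>r t. D r t + D' r t)"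
  by (auto simp: deriv_seq_def intro: has_vector_derivative_add)

lemma deriv_seq_const: "deriv_seq I (\<lambda>r t. if r = 0 then c else 0)"
  by (auto simp: deriv_seq_def)

lemma deriv_seq_linear:
  assumes "bounded_linear L" "deriv_seq I D"
  shows "deriv_seq I (\<lambda>r t. L (D r t))"
  using assms by (auto simp: deriv_seq_def intro: bounded_linear.has_vector_derivative)

lemma nth_vector_derivative_simps:
  "nth_vector_derivative 0 \<gamma> = \<gamma>"
  "nth_vector_derivative (Suc r) \<gamma> = (\<lambda>t. vector_derivative (nth_vector_derivative r \<gamma>) (at t))"
  by (simp_all add: nth_vector_derivative_def)

text \<open>A derivative at \<open>t\<close> depends only on values near \<open>t\<close>; as
  \<open>I\<close> is open these lie in \<open>I\<close>, where the induction hypothesis identifies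
  the two functions.\<close>

lemma deriv_seq_nth_vector_derivative:
  assumes "deriv_seq I D" "open I" "\<And>t. t \<in> I \<Longrightarrow> D 0 t = \<gamma> t" "t \<in> I"
  shows "nth_vector_derivative r \<gamma> t = D r t"
  using assms(4)
proof (induction r arbitrary: t)
  case (Suc r)
  have "(nth_vector_derivative r \<gamma> has_vector_derivative D (Suc r) t) (at t)"
    by (rule has_vector_derivative_transform_within_open[OF deriv_seqD[OF assms(1)]])
      (use Suc assms(2) in auto)
  then show ?case
    by (simp add: nth_vector_derivative_simps vector_derivative_at)
qed (simp add: nth_vector_derivative_simps assms)

lemma smooth_curve_on_iff_deriv_seq:
  assumes "open I"
  shows "smooth_curve_on I \<gamma> \<longleftrightarrow> (\<exists>D. deriv_seq I D \<and> (\<forall>t\<in>I. D 0 t = \<gamma> t))"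
proof
  assume "smooth_curve_on I \<gamma>"
  then have "deriv_seq I (\<lambda>r. nth_vector_derivative r \<gamma>)"
    unfolding smooth_curve_on_def deriv_seq_def nth_vector_derivative_simps
    using vector_derivative_works by blast
  then show "\<exists>D. deriv_seq I D \<and> (\<forall>t\<in>I. D 0 t = \<gamma> t)"
    by (intro exI[of _ "\<lambda>r. nth_vector_derivative r \<gamma>"]) (simp add: nth_vector_derivative_simps)
next
  assume "\<exists>D. deriv_seq I D \<and> (\<forall>t\<in>I. D 0 t = \<gamma> t)"
  then obtain D where D: "deriv_seq I D" "\<And>t. t \<in> I \<Longrightarrow> D 0 t = \<gamma> t"
    by blast
  show "smooth_curve_on I \<gamma>"
    unfolding smooth_curve_on_def
  proof (intro allI ballI)
    fix r t assume t: "t \<in> I"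
    have "(nth_vector_derivative r \<gamma> has_vector_derivative D (Suc r) t) (at t)"
      by (rule has_vector_derivative_transform_within_open[OF deriv_seqD[OF D(1) t] assms t])
        (simp add: deriv_seq_nth_vector_derivative[OF D(1) assms D(2)])
    then show "nth_vector_derivative r \<gamma> differentiable (at t)"
      by (rule differentiableI_vector)
  qed
qed

text \<open>Choosing one derivative in \<open>F\<close> for each member gives a map of
  \<open>F\<close> into itself, whose iterates on \<open>f\<close> form the sequence. Smoothness is
  thus reduced to closure under a single derivation.\<close>

lemma deriv_seq_of_closed_family:
  assumes "\<And>f. f \<in> F \<Longrightarrow> \<exists>g\<in>F. \<forall>t\<in>I. (f has_vector_derivative g t) (at t)" and "f \<in> F"
  obtains D where "deriv_seq I D" "D 0 = f"
proof -
  obtain d where d: "\<And>f. f \<in> F \<Longrightarrow> d f \<in> F \<and> (\<forall>t\<in>I. (f has_vector_derivative d f t) (at t))"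
    using assms(1) by metis
  have "(d ^^ r) f \<in> F" for r
    by (induction r) (use d assms(2) in auto)
  then have "deriv_seq I (\<lambda>r. (d ^^ r) f)"
    using d by (auto simp: deriv_seq_def)
  then show ?thesis
    using that by auto
qed

lemma deriv_seq_unique:
  assumes "deriv_seq I D" "deriv_seq I D'" "open I" "\<And>t. t \<in> I \<Longrightarrow> D 0 t = D' 0 t" "t \<in> I"
  shows "D r t = D' r t"
  using deriv_seq_nth_vector_derivative[OF assms(1,3,4,5)]
    deriv_seq_nth_vector_derivative[OF assms(2,3) refl assms(5)] by simp

lemma has_vector_derivative_vec:
  fixes f :: "real \<Rightarrow> real^'n"
  shows "(f has_vector_derivative f') (at t) \<longleftrightarrow>
    (\<forall>i. ((\<lambda>t. f t $ i) has_vector_derivative f' $ i) (at t))"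
proof -
  have "(f has_derivative (\<lambda>h. h *\<^sub>R f')) (at t) \<longleftrightarrow>
    (\<forall>i. ((\<lambda>t. f t $ i) has_derivative (\<lambda>h. h * f' $ i)) (at t))"
    by (subst has_derivative_componentwise_within) (auto simp: Basis_vec_def inner_axis)
  then show ?thesis
    by (simp add: has_vector_derivative_def)
qed

subsection \<open>Functions of high order at the origin\<close>

text \<open>This is f(t) = O(t^n). The filter \<open>nhds 0\<close> contains the point 0 itself, so
  positive order forces f(0) = 0.\<close>

definition flat :: "nat \<Rightarrow> (real \<Rightarrow> 'a::real_normed_vector) \<Rightarrow> bool" where
  "flat n f \<longleftrightarrow> (\<exists>C. \<forall>\<^sub>F t in nhds 0. norm (f t) \<le> C * \<bar>t\<bar> ^ n)"

lemma deriv_seq_Maclaurin: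
  fixes D :: "nat \<Rightarrow> real \<Rightarrow> real"
  assumes "deriv_seq {-\<delta><..<\<delta>} D" "\<And>k. k < n \<Longrightarrow> D k 0 = 0" "\<bar>x\<bar> < \<delta>"
  shows "\<exists>t. \<bar>t\<bar> \<le> \<bar>x\<bar> \<and> D 0 x = D n t / fact n * x ^ n"
proof -
  have "\<forall>m t. m < n \<and> \<bar>t\<bar> \<le> \<bar>x\<bar> \<longrightarrow> DERIV (D m) t :> D (Suc m) t"
  proof (intro allI impI)
    fix m t assume "m < n \<and> \<bar>t\<bar> \<le> \<bar>x\<bar>"
    then have "t \<in> {-\<delta><..<\<delta>}"
      using assms(3) by auto
    from deriv_seqD[OF assms(1) this] show "DERIV (D m) t :> D (Suc m) t"
      by (simp add: has_real_derivative_iff_has_vector_derivative)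
  qed
  from Maclaurin_bi_le[OF refl this] show ?thesis
    using assms(2) by auto
qed

lemma deriv_seq_cont:
  assumes "deriv_seq I D" "t \<in> I"
  shows "isCont (D r) t"
  using has_vector_derivative_continuous[OF deriv_seqD[OF assms]] .

text \<open>Once the derivatives below order m vanish, the Lagrange remainder makes
  \<open>D 0 x\<close> equal to x^m / m! times \<open>D m\<close> at an intermediate point. The
  bound of order n + 1 > m makes that value O(x), and continuity of \<open>D m\<close> at 0
  concludes.\<close>

lemma flat_deriv_seq_zero_real:
  fixes D :: "nat \<Rightarrow> real \<Rightarrow> real"
  assumes D: "deriv_seq {-\<delta><..<\<delta>} D" and "\<delta> > 0" and "flat (Suc n) (D 0)" and "r \<le> n"
  shows "D r 0 = 0"
  using \<open>r \<le> n\<close>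
proof (induction r rule: less_induct)
  case (less m)
  obtain C \<eta> where C: "\<eta> > 0" "\<And>t. \<bar>t\<bar> < \<eta> \<Longrightarrow> \<bar>D 0 t\<bar> \<le> C * \<bar>t\<bar> ^ Suc n"
    using assms(3) unfolding flat_def eventually_nhds_metric by (auto simp: dist_real_def)
  have ex: "\<exists>t. \<bar>t\<bar> \<le> \<bar>x\<bar> \<and> D 0 x = D m t / fact m * x ^ m" if "\<bar>x\<bar> < \<delta>" for x
    by (rule deriv_seq_Maclaurin[OF D]) (use less that in auto)
  define \<xi> where "\<xi> x = (SOME t. \<bar>t\<bar> \<le> \<bar>x\<bar> \<and> D 0 x = D m t / fact m * x ^ m)" for x
  have \<xi>: "\<bar>\<xi> x\<bar> \<le> \<bar>x\<bar>" "D 0 x = D m (\<xi> x) / fact m * x ^ m" if "\<bar>x\<bar> < \<delta>" for x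
    using someI_ex[OF ex[OF that]] unfolding \<xi>_def by auto
  have ev: "\<forall>\<^sub>F x in at (0::real). \<bar>x\<bar> < \<delta> \<and> \<bar>x\<bar> < \<eta> \<and> \<bar>x\<bar> < 1 \<and> x \<noteq> 0"
    unfolding eventually_at using \<open>\<delta> > 0\<close> C(1)
    by (intro exI[of _ "min (min \<delta> \<eta>) 1"]) (auto simp: dist_real_def)
  have "((\<lambda>x. \<bar>x\<bar>) \<longlongrightarrow> 0) (at (0::real))"
    by (simp add: tendsto_rabs_zero_iff)
  moreover have "\<forall>\<^sub>F x in at 0. norm (\<xi> x) \<le> \<bar>x\<bar>"
    using ev by eventually_elim (use \<xi> in auto)
  ultimately have "(\<xi> \<longlongrightarrow> 0) (at 0)"
    by (rule Lim_null_comparison[rotated])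
  then have lim1: "((\<lambda>x. D m (\<xi> x)) \<longlongrightarrow> D m 0) (at 0)"
    by (rule isCont_tendsto_compose[rotated]) (rule deriv_seq_cont[OF D], use \<open>\<delta> > 0\<close> in simp)
  have "((\<lambda>x. fact m * \<bar>C\<bar> * \<bar>x\<bar>) \<longlongrightarrow> fact m * \<bar>C\<bar> * \<bar>0\<bar>) (at (0::real))"
    by (intro tendsto_intros)
  then have "((\<lambda>x. fact m * \<bar>C\<bar> * \<bar>x\<bar>) \<longlongrightarrow> 0) (at (0::real))"
    by simp
  moreover have "\<forall>\<^sub>F x in at 0. norm (D m (\<xi> x)) \<le> fact m * \<bar>C\<bar> * \<bar>x\<bar>"
    using ev
  proof eventually_elim
    case (elim x)
    then have x: "\<bar>x\<bar> < \<delta>" "\<bar>x\<bar> < \<eta>" "\<bar>x\<bar> < 1" "x \<noteq> 0" by auto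
    have "\<bar>D m (\<xi> x)\<bar> * \<bar>x\<bar> ^ m = fact m * \<bar>D 0 x\<bar>"
      using \<xi>(2)[OF x(1)] by (simp add: abs_mult power_abs)
    also have "\<dots> \<le> fact m * (\<bar>C\<bar> * \<bar>x\<bar> ^ Suc n)"
      by (intro mult_left_mono order_trans[OF C(2)[OF x(2)]] mult_right_mono) auto
    also have "\<dots> \<le> fact m * (\<bar>C\<bar> * \<bar>x\<bar> ^ Suc m)"
      using less.prems x by (intro mult_left_mono power_decreasing) auto
    also have "\<dots> = (fact m * \<bar>C\<bar> * \<bar>x\<bar>) * \<bar>x\<bar> ^ m"
      by simp
    finally show ?case
      using x by simp
  qed
  ultimately have "((\<lambda>x. D m (\<xi> x)) \<longlongrightarrow> 0) (at 0)"
    by (rule Lim_null_comparison[rotated])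
  with lim1 show ?case
    using tendsto_unique[OF _ lim1] by simp
qed

lemma flat_deriv_seq_zero:
  fixes D :: "nat \<Rightarrow> real \<Rightarrow> 'a::euclidean_space"
  assumes D: "deriv_seq {-\<delta><..<\<delta>} D" and "\<delta> > 0" and fl: "flat (Suc n) (D 0)" and "r \<le> n"
  shows "D r 0 = 0"
proof (rule euclidean_eqI)
  fix i :: 'a assume i: "i \<in> Basis"
  obtain C where C: "\<forall>\<^sub>F t in nhds 0. norm (D 0 t) \<le> C * \<bar>t\<bar> ^ Suc n"
    using fl unfolding flat_def by blast
  have "flat (Suc n) (\<lambda>t. D 0 t \<bullet> i)"
    unfolding flat_def
    by (rule exI[of _ C], rule eventually_mono[OF C])
      (use Basis_le_norm[OF i] order_trans in fastforce)
  then have "D r 0 \<bullet> i = 0"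
    using flat_deriv_seq_zero_real[OF deriv_seq_linear[OF bounded_linear_inner_left D] \<open>\<delta> > 0\<close> _ \<open>r \<le> n\<close>]
    by simp
  then show "D r 0 \<bullet> i = 0 \<bullet> i" by simp
qed

text \<open>A converse: only the Lagrange remainder is left, and its coefficient is bounded near 0
  by continuity of \<open>D n\<close>.\<close>

lemma deriv_seq_zero_flat:
  fixes D :: "nat \<Rightarrow> real \<Rightarrow> real"
  assumes D: "deriv_seq {-\<delta><..<\<delta>} D" and "\<delta> > 0" and "\<And>k. k < n \<Longrightarrow> D k 0 = 0"
  shows "flat n (D 0)"
proof -
  have "isCont (D n) 0"
    using deriv_seq_cont[OF D] \<open>\<delta> > 0\<close> by simp
  then obtain \<eta> where \<eta>: "\<eta> > 0" "\<And>t. \<bar>t\<bar> < \<eta> \<Longrightarrow> \<bar>D n t - D n 0\<bar> < 1"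
    unfolding continuous_at_eps_delta by (metis diff_zero dist_real_def zero_less_one)
  show ?thesis
    unfolding flat_def eventually_nhds_metric
  proof (intro exI conjI allI impI)
    show "min \<delta> \<eta> > 0" using \<eta> \<open>\<delta> > 0\<close> by simp
    fix x :: real assume "dist x 0 < min \<delta> \<eta>"
    then have x: "\<bar>x\<bar> < \<delta>" "\<bar>x\<bar> < \<eta>" by (auto simp: dist_real_def)
    obtain t where t: "\<bar>t\<bar> \<le> \<bar>x\<bar>" "D 0 x = D n t / fact n * x ^ n"
      using deriv_seq_Maclaurin[OF D assms(3) x(1)] by blast
    have "\<bar>D n t\<bar> \<le> \<bar>D n 0\<bar> + 1"
      using \<eta>(2)[of t] t x by linarith
    then show "norm (D 0 x) \<le> ((\<bar>D n 0\<bar> + 1) / fact n) * \<bar>x\<bar> ^ n"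
      unfolding t(2) by (simp add: abs_mult power_abs divide_right_mono mult_right_mono)
  qed
qed

text \<open>The mean value estimate on the symmetric interval [-|t|, |t|] gains one order and treats
  both signs of t at once.\<close>

lemma flat_antiderivative:
  fixes f :: "real \<Rightarrow> real"
  assumes "\<And>t. \<bar>t\<bar> < \<delta> \<Longrightarrow> (f has_real_derivative f' t) (at t)" "\<delta> > 0" "f 0 = 0" "flat n f'"
  shows "flat (Suc n) f"
proof -
  obtain C \<eta> where C: "\<eta> > 0" "\<And>t. \<bar>t\<bar> < \<eta> \<Longrightarrow> \<bar>f' t\<bar> \<le> C * \<bar>t\<bar> ^ n"
    using assms(4) unfolding flat_def eventually_nhds_metric by (auto simp: dist_real_def)
  show ?thesis
    unfolding flat_def eventually_nhds_metric
  proof (intro exI conjI allI impI)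
    show "min \<delta> \<eta> > 0" using C assms(2) by simp
    fix t :: real assume "dist t 0 < min \<delta> \<eta>"
    then have t: "\<bar>t\<bar> < \<delta>" "\<bar>t\<bar> < \<eta>" by (auto simp: dist_real_def)
    have "norm (f t - f 0) \<le> (\<bar>C\<bar> * \<bar>t\<bar> ^ n) * norm (t - 0)"
    proof (rule field_differentiable_bound[where f' = f' and S = "{- \<bar>t\<bar>..\<bar>t\<bar>}"])
      fix z assume "z \<in> {- \<bar>t\<bar>..\<bar>t\<bar>}"
      then have z: "\<bar>z\<bar> \<le> \<bar>t\<bar>" by auto
      then show "(f has_field_derivative f' z) (at z within {- \<bar>t\<bar>..\<bar>t\<bar>})"
        using has_field_derivative_at_within[OF assms(1)[of z]] t by auto
      have "\<bar>f' z\<bar> \<le> C * \<bar>z\<bar> ^ n" using C(2) z t by auto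
      also have "\<dots> \<le> \<bar>C\<bar> * \<bar>z\<bar> ^ n" by (intro mult_right_mono) auto
      also have "\<dots> \<le> \<bar>C\<bar> * \<bar>t\<bar> ^ n" using z by (intro mult_left_mono power_mono) auto
      finally show "norm (f' z) \<le> \<bar>C\<bar> * \<bar>t\<bar> ^ n" by simp
    qed auto
    then show "norm (f t) \<le> \<bar>C\<bar> * \<bar>t\<bar> ^ Suc n"
      using assms(3) by (simp add: mult_ac)
  qed
qed

lemma flat_dominated:
  assumes "flat n g" "\<forall>\<^sub>F t in nhds 0. norm (f t) \<le> K * norm (g t)" "0 \<le> K"
  shows "flat n f"
proof -
  obtain C where C: "\<forall>\<^sub>F t in nhds 0. norm (g t) \<le> C * \<bar>t\<bar> ^ n"
    using assms(1) unfolding flat_def by blast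
  from C assms(2) have "\<forall>\<^sub>F t in nhds 0. norm (f t) \<le> (K * C) * \<bar>t\<bar> ^ n"
  proof eventually_elim
    case (elim t)
    have "K * norm (g t) \<le> K * (C * \<bar>t\<bar> ^ n)" using elim(1) assms(3) by (rule mult_left_mono)
    with elim(2) show ?case by simp
  qed
  then show ?thesis unfolding flat_def by blast
qed

lemma flat_add:
  assumes "flat n f" "flat n g"
  shows "flat n (\<lambda>t. f t + g t)"
proof -
  obtain C C' where "\<forall>\<^sub>F t in nhds 0. norm (f t) \<le> C * \<bar>t\<bar> ^ n" "\<forall>\<^sub>F t in nhds 0. norm (g t) \<le> C' * \<bar>t\<bar> ^ n"
    using assms unfolding flat_def by blast
  then have "\<forall>\<^sub>F t in nhds 0. norm (f t + g t) \<le> (C + C') * \<bar>t\<bar> ^ n"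
  proof eventually_elim
    case (elim t)
    then show ?case using norm_triangle_ineq[of "f t" "g t"] by (simp add: distrib_right)
  qed
  then show ?thesis unfolding flat_def by blast
qed

lemma flat_scaleR:
  "flat n f \<Longrightarrow> flat n (\<lambda>t. f t *\<^sub>R (u::'a::real_normed_vector))"
  by (rule flat_dominated[where g = f and K = "norm u"]) (auto simp: mult.commute)

lemma flat_compose_lipschitz:
  assumes f: "flat n f" and s: "\<forall>\<^sub>F t in nhds 0. \<bar>s t\<bar> \<le> K * \<bar>t\<bar>" and "0 \<le> K"
  shows "flat n (\<lambda>t. f (s t))"
proof -
  obtain C \<eta> where C: "\<eta> > 0" "\<And>t. \<bar>t\<bar> < \<eta> \<Longrightarrow> norm (f t) \<le> C * \<bar>t\<bar> ^ n"
    using f unfolding flat_def eventually_nhds_metric by (auto simp: dist_real_def)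
  \<comment> \<open>Dividing by K + 1 instead of K also covers K = 0.\<close>
  have "\<forall>\<^sub>F t in nhds 0. \<bar>t\<bar> < \<eta> / (K + 1)"
    unfolding eventually_nhds_metric using C \<open>0 \<le> K\<close>
    by (intro exI[of _ "\<eta> / (K + 1)"]) (auto simp: dist_real_def)
  with s have "\<forall>\<^sub>F t in nhds 0. norm (f (s t)) \<le> (\<bar>C\<bar> * K ^ n) * \<bar>t\<bar> ^ n"
  proof eventually_elim
    case (elim t)
    have "(K + 1) * \<bar>t\<bar> < \<eta>" using elim(2) \<open>0 \<le> K\<close> by (simp add: field_simps)
    then have "\<bar>s t\<bar> < \<eta>" using elim(1) by (simp add: distrib_right)
    then have "norm (f (s t)) \<le> C * \<bar>s t\<bar> ^ n" by (rule C)
    also have "\<dots> \<le> \<bar>C\<bar> * \<bar>s t\<bar> ^ n" by (intro mult_right_mono) auto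
    also have "\<dots> \<le> \<bar>C\<bar> * (K * \<bar>t\<bar>) ^ n" using elim(1) by (intro mult_left_mono power_mono) auto
    finally show ?case by (simp add: power_mult_distrib mult_ac)
  qed
  then show ?thesis unfolding flat_def by blast
qed

lemma eventually_abs_less: "\<delta> > 0 \<Longrightarrow> \<forall>\<^sub>F t in nhds 0. \<bar>t::real\<bar> < \<delta>"
  unfolding eventually_nhds_metric by (intro exI[of _ \<delta>]) (auto simp: dist_real_def)

subsection \<open>Algebras of functions closed under derivation\<close>

text \<open>The algebra of functions generated by \<open>G\<close>. It has no quotients or roots;
  where one is needed it has to be a generator.\<close>

inductive_set alg :: "(real \<Rightarrow> real) set \<Rightarrow> (real \<Rightarrow> real) set" for G where
  gen: "f \<in> G \<Longrightarrow> f \<in> alg G"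
| const: "(\<lambda>_. c) \<in> alg G"
| add: "f \<in> alg G \<Longrightarrow> g \<in> alg G \<Longrightarrow> (\<lambda>t. f t + g t) \<in> alg G"
| mult: "f \<in> alg G \<Longrightarrow> g \<in> alg G \<Longrightarrow> (\<lambda>t. f t * g t) \<in> alg G"

lemma alg_diff: "f \<in> alg G \<Longrightarrow> g \<in> alg G \<Longrightarrow> (\<lambda>t. f t - g t) \<in> alg G"
  using alg.add[OF _ alg.mult[OF alg.const[of "-1"]], of f G g] by simp

lemma alg_mono: "f \<in> alg G \<Longrightarrow> G \<subseteq> H \<Longrightarrow> f \<in> alg H"
  by (induction rule: alg.induct) (auto intro: alg.intros)

text \<open>Sum and product rule. Two generating sets occur because derivatives of the generators in
  \<open>G\<close> may involve further generators; for \<open>G = H\<close> this is closure under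
  derivation.\<close>

lemma alg_deriv:
  assumes "f \<in> alg G" "G \<subseteq> H"
    and "\<And>g. g \<in> G \<Longrightarrow> \<exists>h\<in>alg H. \<forall>t\<in>I. (g has_real_derivative h t) (at t)"
  shows "\<exists>h\<in>alg H. \<forall>t\<in>I. (f has_real_derivative h t) (at t)"
  using assms(1)
proof (induction rule: alg.induct)
  case (gen f) then show ?case using assms(3) by blast
next
  case (const c)
  then show ?case by (intro bexI[of _ "\<lambda>_. 0"]) (auto intro: alg.const)
next
  case (add f g)
  then obtain f' g' where *: "f' \<in> alg H" "\<forall>t\<in>I. (f has_real_derivative f' t) (at t)"
    "g' \<in> alg H" "\<forall>t\<in>I. (g has_real_derivative g' t) (at t)" by blast
  then show ?case
    by (intro bexI[of _ "\<lambda>t. f' t + g' t"]) (auto intro: alg.add DERIV_add)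
next
  case (mult f g)
  then obtain f' g' where *: "f' \<in> alg H" "\<forall>t\<in>I. (f has_real_derivative f' t) (at t)"
    "g' \<in> alg H" "\<forall>t\<in>I. (g has_real_derivative g' t) (at t)" by blast
  have "f \<in> alg H" "g \<in> alg H"
    using mult assms(2) alg_mono by blast+
  with * show ?case
    by (intro bexI[of _ "\<lambda>t. f' t * g t + g' t * f t"]) (auto intro: alg.add alg.mult DERIV_mult)
qed

lemma alg_deriv_seq:
  assumes "\<And>g. g \<in> G \<Longrightarrow> \<exists>h\<in>alg G. \<forall>t\<in>I. (g has_real_derivative h t) (at t)" and "f \<in> alg G"
  obtains D where "deriv_seq I D" "D 0 = f"
proof (rule deriv_seq_of_closed_family[OF _ assms(2)])
  show "\<exists>g\<in>alg G. \<forall>t\<in>I. (f has_vector_derivative g t) (at t)" if "f \<in> alg G" for f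
    using alg_deriv[OF that order_refl assms(1)]
    by (simp add: has_real_derivative_iff_has_vector_derivative)
qed

lemma alg_deriv_seq_vec:
  fixes f :: "real \<Rightarrow> real^'n"
  assumes "\<And>g. g \<in> G \<Longrightarrow> \<exists>h\<in>alg G. \<forall>t\<in>I. (g has_real_derivative h t) (at t)"
    and "\<And>i. (\<lambda>t. f t $ i) \<in> alg G"
  obtains D where "deriv_seq I D" "D 0 = f"
proof (rule deriv_seq_of_closed_family[where F = "{f. \<forall>i. (\<lambda>t. f t $ i) \<in> alg G}"])
  fix f :: "real \<Rightarrow> real^'n" assume "f \<in> {f. \<forall>i. (\<lambda>t. f t $ i) \<in> alg G}"
  then have "\<forall>i. \<exists>g\<in>alg G. \<forall>t\<in>I. ((\<lambda>t. f t $ i) has_real_derivative g t) (at t)"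
    using alg_deriv[OF _ order_refl assms(1)] by blast
  then obtain g where g: "\<And>i. g i \<in> alg G"
      "\<And>i t. t \<in> I \<Longrightarrow> ((\<lambda>t. f t $ i) has_real_derivative g i t) (at t)"
    by metis
  then show "\<exists>g\<in>{f. \<forall>i. (\<lambda>t. f t $ i) \<in> alg G}. \<forall>t\<in>I. (f has_vector_derivative g t) (at t)"
    by (intro bexI[of _ "\<lambda>t. \<chi> i. g i t"])
      (auto simp: has_vector_derivative_vec has_real_derivative_iff_has_vector_derivative)
qed (use assms(2) in auto)

text \<open>The offset \<open>k\<close> absorbs a coordinate of the base point, and the free
  frequency \<open>c\<close> covers both \<open>a\<close> and \<open>b\<close>.\<close>

inductive_set trig_gens :: "(real \<Rightarrow> real) \<Rightarrow> (real \<Rightarrow> real) \<Rightarrow> (real \<Rightarrow> real) set" for X Y where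
  "(\<lambda>t. sin (c * (k + X t))) \<in> trig_gens X Y"
| "(\<lambda>t. cos (c * (k + X t))) \<in> trig_gens X Y"
| "(\<lambda>t. sinh (c * (k + Y t))) \<in> trig_gens X Y"
| "(\<lambda>t. cosh (c * (k + Y t))) \<in> trig_gens X Y"

lemma trig_gens_0:
  "(\<lambda>t. sin (c * X t)) \<in> trig_gens X Y" "(\<lambda>t. cos (c * X t)) \<in> trig_gens X Y"
  "(\<lambda>t. sinh (c * Y t)) \<in> trig_gens X Y" "(\<lambda>t. cosh (c * Y t)) \<in> trig_gens X Y"
  using trig_gens.intros[where k = 0] by simp_all

text \<open>By the chain rule each derivative is a constant times another generator times
  \<open>X'\<close> or \<open>Y'\<close>, and these two factors may need the larger set
  \<open>H\<close>.\<close>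

lemma trig_gens_deriv:
  assumes "g \<in> trig_gens X Y" "trig_gens X Y \<subseteq> H" "X' \<in> alg H" "Y' \<in> alg H"
    and "\<And>t. t \<in> I \<Longrightarrow> (X has_real_derivative X' t) (at t)"
    and "\<And>t. t \<in> I \<Longrightarrow> (Y has_real_derivative Y' t) (at t)"
  shows "\<exists>h\<in>alg H. \<forall>t\<in>I. (g has_real_derivative h t) (at t)"
proof -
  have H: "h \<in> alg H" if "h \<in> trig_gens X Y" for h
    using that assms(2) by (auto intro: alg.gen)
  note mult = alg.mult[OF alg.mult[OF alg.const H]]
  show ?thesis
    using assms(1)
  proof cases
    case (1 c k)
    show ?thesis
    proof (rule bexI)
      show "\<forall>t\<in>I. (g has_real_derivative (c * cos (c * (k + X t))) * X' t) (at t)"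
        unfolding 1 by (auto intro!: derivative_eq_intros assms(5,6))
    qed (rule mult[OF trig_gens.intros(2) assms(3)])
  next
    case (2 c k)
    show ?thesis
    proof (rule bexI)
      show "\<forall>t\<in>I. (g has_real_derivative ((- c) * sin (c * (k + X t))) * X' t) (at t)"
        unfolding 2 by (auto intro!: derivative_eq_intros assms(5,6))
    qed (rule mult[OF trig_gens.intros(1) assms(3)])
  next
    case (3 c k)
    show ?thesis
    proof (rule bexI)
      show "\<forall>t\<in>I. (g has_real_derivative (c * cosh (c * (k + Y t))) * Y' t) (at t)"
        unfolding 3 by (auto intro!: derivative_eq_intros assms(5,6))
    qed (rule mult[OF trig_gens.intros(4) assms(4)])
  next
    case (4 c k)
    show ?thesis
    proof (rule bexI)
      show "\<forall>t\<in>I. (g has_real_derivative (c * sinh (c * (k + Y t))) * Y' t) (at t)"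
        unfolding 4 by (auto intro!: derivative_eq_intros assms(5,6))
    qed (rule mult[OF trig_gens.intros(3) assms(4)])
  qed
qed

subsection \<open>Implicit curves of unit speed\<close>

text \<open>The order of \<open>a\<close> and \<open>b\<close> is left open, so the location of the
  mean value point is expressed by its distances to both.\<close>

lemma real_mvt:
  fixes f :: "real \<Rightarrow> real"
  assumes "\<And>x. (f has_real_derivative f' x) (at x)"
  obtains \<xi> where "\<bar>\<xi> - a\<bar> \<le> \<bar>b - a\<bar>" "\<bar>\<xi> - b\<bar> \<le> \<bar>b - a\<bar>" "f b - f a = f' \<xi> * (b - a)"
proof (cases a b rule: linorder_cases)
  case less
  from MVT2[OF this, of f f'] assms obtain z where "a < z" "z < b" "f b - f a = (b - a) * f' z" by blast
  then show ?thesis by (intro that[of z]) auto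
next
  case equal
  then show ?thesis by (intro that[of a]) auto
next
  case greater
  from MVT2[OF this, of f f'] assms obtain z where "b < z" "z < a" "f a - f b = (a - b) * f' z" by blast
  then show ?thesis by (intro that[of z]) (auto simp: algebra_simps)
qed

text \<open>In a small box |G(s, 0)| is at most r/4, while G grows in w at rate at least 1/2. Hence
  G(s, -r) < 0 < G(s, r), and for each s there is exactly one zero. The box is explicit because the
  whole zero set in it has to be known, not only one branch.\<close>

lemma implicit_function_box:
  fixes G Gs Gw :: "real \<Rightarrow> real \<Rightarrow> real"
  assumes ds: "\<And>s w. ((\<lambda>s. G s w) has_real_derivative Gs s w) (at s)"
    and dw: "\<And>s w. ((\<lambda>w. G s w) has_real_derivative Gw s w) (at w)"
    and cs: "continuous_on UNIV (\<lambda>(s, w). Gs s w)"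
    and cw: "continuous_on UNIV (\<lambda>(s, w). Gw s w)"
    and G0: "G 0 0 = 0" "Gs 0 0 = 0" "Gw 0 0 = 1" and "R > 0"
  obtains r f where "0 < r" "r \<le> R" "f 0 = 0"
    "\<And>s w. \<bar>s\<bar> \<le> r \<Longrightarrow> \<bar>w\<bar> \<le> r \<Longrightarrow> \<bar>Gs s w\<bar> < 1/4 \<and> 1/2 < Gw s w"
    "\<And>s. \<bar>s\<bar> \<le> r \<Longrightarrow> \<bar>f s\<bar> < r \<and> G s (f s) = 0"
    "\<And>s w. \<bar>s\<bar> \<le> r \<Longrightarrow> \<bar>w\<bar> \<le> r \<Longrightarrow> G s w = 0 \<Longrightarrow> w = f s"
    "\<And>s. \<bar>s\<bar> \<le> r \<Longrightarrow> \<bar>f s\<bar> \<le> 2 * \<bar>G s 0\<bar>"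
    "\<And>s. \<bar>s\<bar> < r \<Longrightarrow> (f has_real_derivative - Gs s (f s) / Gw s (f s)) (at s)"
proof -
  have iso: "isCont (\<lambda>(s, w). Gs s w) z" "isCont (\<lambda>(s, w). Gw s w) z" for z
    using cs cw continuous_on_eq_continuous_at[OF open_UNIV] by blast+
  have "\<forall>\<^sub>F z in nhds (0, 0). \<bar>case z of (s, w) \<Rightarrow> Gs s w\<bar> < 1/4 \<and> 1/2 < (case z of (s, w) \<Rightarrow> Gw s w)"
  proof (intro eventually_conj)
    have "((\<lambda>z. \<bar>case z of (s, w) \<Rightarrow> Gs s w\<bar>) \<longlongrightarrow> \<bar>Gs 0 0\<bar>) (nhds (0, 0))"
      using tendsto_rabs[OF iso(1)[of "(0, 0)", unfolded isCont_def tendsto_at_iff_tendsto_nhds]] by simp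
    then show "\<forall>\<^sub>F z in nhds (0, 0). \<bar>case z of (s, w) \<Rightarrow> Gs s w\<bar> < 1/4"
      by (rule order_tendstoD) (simp add: G0)
    have "((\<lambda>z. case z of (s, w) \<Rightarrow> Gw s w) \<longlongrightarrow> Gw 0 0) (nhds (0, 0))"
      using iso(2)[of "(0, 0)", unfolded isCont_def tendsto_at_iff_tendsto_nhds] by simp
    then show "\<forall>\<^sub>F z in nhds (0, 0). 1/2 < (case z of (s, w) \<Rightarrow> Gw s w)"
      by (rule order_tendstoD) (simp add: G0)
  qed
  then obtain e where e: "e > 0" "\<And>s w. dist (s, w) (0, 0) < e \<Longrightarrow> \<bar>Gs s w\<bar> < 1/4 \<and> 1/2 < Gw s w"
    unfolding eventually_nhds_metric by fastforce
  \<comment> \<open>In the box the distance to the origin is at most 2 r, which is less than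
    e.\<close>
  define r where "r = min R (e / 3)"
  have r: "r > 0" "r \<le> R" "3 * r \<le> e" using e \<open>R > 0\<close> by (auto simp: r_def)
  have box: "\<bar>Gs s w\<bar> < 1/4 \<and> 1/2 < Gw s w" if "\<bar>s\<bar> \<le> r" "\<bar>w\<bar> \<le> r" for s w
  proof -
    have "dist (s, w) (0, 0) \<le> \<bar>s\<bar> + \<bar>w\<bar>"
      using norm_Pair_le[of s w] by (simp add: dist_norm)
    then show ?thesis using e(2)[of s w] that r by linarith
  qed
  have sdiff: "\<bar>G s w - G s' w\<bar> \<le> \<bar>s - s'\<bar> / 4" if "\<bar>s\<bar> \<le> r" "\<bar>s'\<bar> \<le> r" "\<bar>w\<bar> \<le> r" for s s' w
  proof -
    obtain \<xi> where \<xi>: "\<bar>\<xi> - s'\<bar> \<le> \<bar>s - s'\<bar>" "\<bar>\<xi> - s\<bar> \<le> \<bar>s - s'\<bar>" "G s w - G s' w = Gs \<xi> w * (s - s')"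
      using real_mvt[of "\<lambda>s. G s w" "\<lambda>s. Gs s w" s' s] ds by blast
    have "\<bar>\<xi>\<bar> \<le> r" using \<xi> that by linarith
    then have "\<bar>Gs \<xi> w\<bar> \<le> 1/4" using box that by fastforce
    then have "\<bar>Gs \<xi> w\<bar> * \<bar>s - s'\<bar> \<le> 1/4 * \<bar>s - s'\<bar>" by (intro mult_right_mono) auto
    then show ?thesis by (simp add: \<xi>(3) abs_mult)
  qed
  have wdiff: "G s w - G s w' \<ge> (w - w') / 2" if "\<bar>s\<bar> \<le> r" "\<bar>w\<bar> \<le> r" "\<bar>w'\<bar> \<le> r" "w' \<le> w" for s w w'
  proof -
    obtain \<xi> where \<xi>: "\<bar>\<xi> - w'\<bar> \<le> \<bar>w - w'\<bar>" "\<bar>\<xi> - w\<bar> \<le> \<bar>w - w'\<bar>" "G s w - G s w' = Gw s \<xi> * (w - w')"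
      using real_mvt[of "\<lambda>w. G s w" "\<lambda>w. Gw s w" w' w] dw by blast
    have "\<bar>\<xi>\<bar> \<le> r" using \<xi> that by linarith
    then have "1/2 \<le> Gw s \<xi>" using box that by fastforce
    then have "1/2 * (w - w') \<le> Gw s \<xi> * (w - w')" using that by (intro mult_right_mono) auto
    then show ?thesis by (simp add: \<xi>(3))
  qed
  have wdiff': "\<bar>G s w - G s w'\<bar> \<ge> \<bar>w - w'\<bar> / 2" if "\<bar>s\<bar> \<le> r" "\<bar>w\<bar> \<le> r" "\<bar>w'\<bar> \<le> r" for s w w'
    using wdiff[of s w w'] wdiff[of s w' w] that by (cases "w \<le> w'") (auto simp: abs_if)
  have ex: "\<exists>w. \<bar>w\<bar> < r \<and> G s w = 0" if s: "\<bar>s\<bar> \<le> r" for s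
  proof -
    have G: "\<bar>G s 0\<bar> \<le> r / 4" using sdiff[of s 0 0] s r G0 by auto
    have "G s r > 0" "G s (-r) < 0"
      using wdiff[of s r 0] wdiff[of s 0 "-r"] G s r by auto
    moreover have "continuous_on {-r..r} (G s)"
      by (rule DERIV_continuous_on[of _ _ "Gw s"]) (use dw in \<open>auto intro: has_field_derivative_at_within\<close>)
    ultimately obtain w where w: "-r \<le> w" "w \<le> r" "G s w = 0"
      using IVT'[of "G s" "-r" 0 r] r by auto
    with \<open>G s r > 0\<close> \<open>G s (-r) < 0\<close> have "w \<noteq> r" "w \<noteq> -r" by auto
    with w show ?thesis by (intro exI[of _ w]) auto
  qed
  define f where "f s = (SOME w. \<bar>w\<bar> < r \<and> G s w = 0)" for s
  have f: "\<bar>f s\<bar> < r" "G s (f s) = 0" if "\<bar>s\<bar> \<le> r" for s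
    using someI_ex[OF ex[OF that]] unfolding f_def by auto
  have uniq: "w = f s" if "\<bar>s\<bar> \<le> r" "\<bar>w\<bar> \<le> r" "G s w = 0" for s w
    using wdiff'[of s w "f s"] that f[of s] by auto
  have lip: "\<bar>f s - f s'\<bar> \<le> \<bar>s - s'\<bar> / 2" if s: "\<bar>s\<bar> \<le> r" "\<bar>s'\<bar> \<le> r" for s s'
    using sdiff[of s s' "f s"] wdiff'[of s' "f s" "f s'"] s f[of s] f[of s'] by auto
  have der: "(f has_real_derivative - Gs s (f s) / Gw s (f s)) (at s)" if s: "\<bar>s\<bar> < r" for s
  proof -
    \<comment> \<open>The increment of \<open>G\<close> between two points of the graph is zero. It
      is split into a step in s and a step in w, each with its mean value point; as these points
      converge, the difference quotient of \<open>f\<close> tends to - Gs / Gw.\<close>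
    have "\<exists>\<xi> \<eta>. \<bar>\<xi> - s\<bar> \<le> \<bar>s' - s\<bar> \<and> \<bar>\<eta> - f s\<bar> \<le> \<bar>f s' - f s\<bar> \<and> \<bar>\<eta> - f s'\<bar> \<le> \<bar>f s' - f s\<bar> \<and>
        G s' (f s') - G s (f s) = Gs \<xi> (f s') * (s' - s) + Gw s \<eta> * (f s' - f s)" for s'
    proof -
      obtain \<xi> where \<xi>: "\<bar>\<xi> - s\<bar> \<le> \<bar>s' - s\<bar>" "G s' (f s') - G s (f s') = Gs \<xi> (f s') * (s' - s)"
        using real_mvt[of "\<lambda>x. G x (f s')" "\<lambda>x. Gs x (f s')" s s'] ds by blast
      obtain \<eta> where \<eta>: "\<bar>\<eta> - f s\<bar> \<le> \<bar>f s' - f s\<bar>" "\<bar>\<eta> - f s'\<bar> \<le> \<bar>f s' - f s\<bar>" "G s (f s') - G s (f s) = Gw s \<eta> * (f s' - f s)"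
        using real_mvt[of "\<lambda>x. G s x" "\<lambda>x. Gw s x" "f s" "f s'"] dw by blast
      show ?thesis using \<xi> \<eta> by (intro exI[of _ \<xi>] exI[of _ \<eta>]) auto
    qed
    then obtain \<xi> \<eta> where \<xi>: "\<And>s'. \<bar>\<xi> s' - s\<bar> \<le> \<bar>s' - s\<bar>"
      and \<eta>: "\<And>s'. \<bar>\<eta> s' - f s\<bar> \<le> \<bar>f s' - f s\<bar>"
      and \<eta>': "\<And>s'. \<bar>\<eta> s' - f s'\<bar> \<le> \<bar>f s' - f s\<bar>"
      and eq: "\<And>s'. G s' (f s') - G s (f s) = Gs (\<xi> s') (f s') * (s' - s) + Gw s (\<eta> s') * (f s' - f s)"
      by metis
    have ev: "\<forall>\<^sub>F s' in at s. \<bar>s'\<bar> < r \<and> s' \<noteq> s"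
      unfolding eventually_at using s
      by (intro exI[of _ "r - \<bar>s\<bar>"]) (auto simp: dist_real_def)
    have fl: "\<bar>f s' - f s\<bar> \<le> \<bar>s' - s\<bar>" if "\<bar>s'\<bar> < r" for s'
      by (rule order_trans[OF lip]) (use s that in auto)
    have lim0: "((\<lambda>s'. \<bar>s' - s\<bar>) \<longlongrightarrow> 0) (at s)"
      by (intro tendsto_eq_intros) auto
    have "((\<lambda>s'. \<xi> s' - s) \<longlongrightarrow> 0) (at s)"
      by (rule Lim_null_comparison[OF _ lim0]) (use \<xi> in auto)
    then have \<xi>lim: "(\<xi> \<longlongrightarrow> s) (at s)" using LIM_zero_iff by blast
    have "((\<lambda>s'. f s' - f s) \<longlongrightarrow> 0) (at s)"
      by (rule Lim_null_comparison[OF _ lim0], rule eventually_mono[OF ev]) (use fl in auto)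
    then have flim: "(f \<longlongrightarrow> f s) (at s)" using LIM_zero_iff by blast
    have "((\<lambda>s'. \<eta> s' - f s) \<longlongrightarrow> 0) (at s)"
      by (rule Lim_null_comparison[OF _ lim0], rule eventually_mono[OF ev])
        (use fl \<eta> order_trans in fastforce)
    then have \<eta>lim: "(\<eta> \<longlongrightarrow> f s) (at s)" using LIM_zero_iff by blast
    have "((\<lambda>s'. case (\<xi> s', f s') of (s, w) \<Rightarrow> Gs s w) \<longlongrightarrow> Gs s (f s)) (at s)"
      using isCont_tendsto_compose[OF iso(1) tendsto_Pair[OF \<xi>lim flim]] by simp
    then have l1: "((\<lambda>s'. Gs (\<xi> s') (f s')) \<longlongrightarrow> Gs s (f s)) (at s)" by simp
    have "((\<lambda>s'. case (s, \<eta> s') of (s, w) \<Rightarrow> Gw s w) \<longlongrightarrow> Gw s (f s)) (at s)"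
      using isCont_tendsto_compose[OF iso(2) tendsto_Pair[OF tendsto_const \<eta>lim]] by simp
    then have l2: "((\<lambda>s'. Gw s (\<eta> s')) \<longlongrightarrow> Gw s (f s)) (at s)" by simp
    have nz: "Gw s (f s) \<noteq> 0" using box[of s "f s"] f[of s] s by auto
    have "((\<lambda>s'. - Gs (\<xi> s') (f s') / Gw s (\<eta> s')) \<longlongrightarrow> - Gs s (f s) / Gw s (f s)) (at s)"
      by (intro tendsto_divide tendsto_minus l1 l2 nz)
    moreover have "\<forall>\<^sub>F s' in at s. - Gs (\<xi> s') (f s') / Gw s (\<eta> s') = (f s' - f s) / (s' - s)"
      using ev
    proof eventually_elim
      case (elim s')
      have "\<bar>\<eta> s'\<bar> \<le> r"
        using \<eta>[of s'] \<eta>'[of s'] f[of s] f[of s'] s elim by linarith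
      then have "Gw s (\<eta> s') \<noteq> 0" using box[of s "\<eta> s'"] s by auto
      moreover have "Gs (\<xi> s') (f s') * (s' - s) + Gw s (\<eta> s') * (f s' - f s) = 0"
        using eq[of s'] f[of s] f[of s'] s elim by auto
      ultimately show ?case using elim by (simp add: divide_simps) (simp add: algebra_simps)
    qed
    ultimately have "((\<lambda>s'. (f s' - f s) / (s' - s)) \<longlongrightarrow> - Gs s (f s) / Gw s (f s)) (at s)"
      by (rule Lim_transform_eventually)
    then show ?thesis by (simp add: has_field_derivative_iff)
  qed
  show thesis
  proof (rule that[of r f])
    show "f 0 = 0" using uniq[of 0 0] G0 r by auto
    show "\<bar>f s\<bar> \<le> 2 * \<bar>G s 0\<bar>" if "\<bar>s\<bar> \<le> r" for s
      using wdiff'[of s "f s" 0] f[of s] that r by auto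
  qed (use r box f uniq der in auto)
qed

text \<open>Separation of variables: the integral \<open>T\<close> of 1 / k from 0 is strictly
  increasing, and its inverse function is the solution.\<close>

lemma autonomous_ode_local:
  fixes k :: "real \<Rightarrow> real"
  assumes "\<rho> > 0" and cont: "continuous_on {-\<rho>..\<rho>} k" and pos: "\<And>x. \<bar>x\<bar> \<le> \<rho> \<Longrightarrow> k x > 0"
  obtains \<delta> s where "\<delta> > 0" "s 0 = 0" "\<And>t. \<bar>t\<bar> < \<delta> \<Longrightarrow> \<bar>s t\<bar> < \<rho>"
    "\<And>t. \<bar>t\<bar> < \<delta> \<Longrightarrow> (s has_real_derivative k (s t)) (at t)" "open (s ` {-\<delta><..<\<delta>})"
proof -
  have "continuous_on {-\<rho>..\<rho>} (\<lambda>x. 1 / k x)"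
    by (intro continuous_intros cont) (use pos in \<open>metis abs_le_iff atLeastAtMost_iff minus_le_iff order_less_irrefl\<close>)
  then obtain T0 where T0: "\<And>x. x \<in> {-\<rho>..\<rho>} \<Longrightarrow> (T0 has_vector_derivative 1 / k x) (at x within {-\<rho>..\<rho>})"
    using antiderivative_continuous by blast
  define T where "T x = T0 x - T0 0" for x
  have Tw: "(T has_real_derivative 1 / k x) (at x within {-\<rho>..\<rho>})" if "x \<in> {-\<rho>..\<rho>}" for x
    unfolding T_def
    using T0[OF that] by (auto simp: has_real_derivative_iff_has_vector_derivative intro!: derivative_eq_intros)
  have Td: "(T has_real_derivative 1 / k x) (at x)" if "\<bar>x\<bar> < \<rho>" for x
    using Tw[of x] at_within_interior[of x "{-\<rho>..\<rho>}"] that by (auto simp: abs_less_iff)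
  have Tc: "continuous_on {-\<rho>..\<rho>} T"
    by (rule DERIV_continuous_on) (rule Tw)
  have mono: "T x < T y" if "x < y" "-\<rho> \<le> x" "y \<le> \<rho>" for x y
  proof (rule DERIV_pos_imp_increasing_open[OF \<open>x < y\<close>])
    fix z assume "x < z" "z < y"
    then have "\<bar>z\<bar> < \<rho>" using that by auto
    then show "\<exists>D. DERIV T z :> D \<and> D > 0" using Td[of z] pos[of z] by (intro exI[of _ "1 / k z"]) auto
  qed (use continuous_on_subset[OF Tc] that in auto)
  have T00: "T 0 = 0" by (simp add: T_def)
  \<comment> \<open>Every t with |t| < \<delta> is then a value of \<open>T\<close> at an interior
    point.\<close>
  define \<delta> where "\<delta> = min (T \<rho>) (- T (-\<rho>))"
  have d: "\<delta> > 0" using mono[of 0 \<rho>] mono[of "-\<rho>" 0] \<open>\<rho> > 0\<close> T00 by (auto simp: \<delta>_def)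
  have ex: "\<exists>x. \<bar>x\<bar> < \<rho> \<and> T x = t" if "\<bar>t\<bar> < \<delta>" for t
  proof -
    have "T (-\<rho>) < t" "t < T \<rho>" using that by (auto simp: \<delta>_def)
    then obtain x where x: "-\<rho> \<le> x" "x \<le> \<rho>" "T x = t"
      using IVT'[of T "-\<rho>" t \<rho>] Tc \<open>\<rho> > 0\<close> by auto
    moreover have "x \<noteq> -\<rho>" "x \<noteq> \<rho>" using x \<open>T (-\<rho>) < t\<close> \<open>t < T \<rho>\<close> by auto
    ultimately show ?thesis by (intro exI[of _ x]) auto
  qed
  define s where "s t = (SOME x. \<bar>x\<bar> < \<rho> \<and> T x = t)" for t
  have s: "\<bar>s t\<bar> < \<rho>" "T (s t) = t" if "\<bar>t\<bar> < \<delta>" for t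
    using someI_ex[OF ex[OF that]] unfolding s_def by auto
  have sT: "s (T x) = x" if "\<bar>x\<bar> < \<rho>" "\<bar>T x\<bar> < \<delta>" for x
    using mono[of "s (T x)" x] mono[of x "s (T x)"] s[OF that(2)] that
    by (cases "s (T x)" x rule: linorder_cases) (auto simp: abs_less_iff)
  have img: "s ` {-\<delta><..<\<delta>} = {-\<rho><..<\<rho>} \<inter> T -` {-\<delta><..<\<delta>}"
  proof (intro equalityI subsetI)
    fix x assume "x \<in> s ` {-\<delta><..<\<delta>}"
    then obtain t where "x = s t" "\<bar>t\<bar> < \<delta>" by (auto simp: abs_less_iff)
    then show "x \<in> {-\<rho><..<\<rho>} \<inter> T -` {-\<delta><..<\<delta>}" using s[of t] by auto
  next
    fix x assume "x \<in> {-\<rho><..<\<rho>} \<inter> T -` {-\<delta><..<\<delta>}"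
    then show "x \<in> s ` {-\<delta><..<\<delta>}" using sT[of x] by (intro image_eqI[of _ _ "T x"]) auto
  qed
  have op: "open (s ` {-\<delta><..<\<delta>})"
    unfolding img by (rule continuous_open_preimage[OF continuous_on_subset[OF Tc]]) auto
  have mono_s: "s t < s t'" if "t < t'" "\<bar>t\<bar> < \<delta>" "\<bar>t'\<bar> < \<delta>" for t t'
  proof (rule ccontr)
    assume "\<not> s t < s t'"
    then have "T (s t') \<le> T (s t)"
      using mono[of "s t'" "s t"] s[of t] s[of t'] that
      by (cases "s t' = s t") (auto simp: abs_less_iff)
    with s that show False by auto
  qed
  have sc: "isCont s t" if "\<bar>t\<bar> < \<delta>" for t
  proof -
    have "continuous_on {-\<delta><..<\<delta>} s"
    proof (rule continuous_onI_mono)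
      show "s x \<le> s y" if "x \<in> {-\<delta><..<\<delta>}" "y \<in> {-\<delta><..<\<delta>}" "x \<le> y" for x y
        using mono_s[of x y] that by (cases "x = y") (auto simp: abs_less_iff)
    qed (rule op)
    then show ?thesis using that by (simp add: continuous_on_eq_continuous_at abs_less_iff)
  qed
  show thesis
  proof (rule that[of \<delta> s])
    fix t assume t: "\<bar>t\<bar> < \<delta>"
    have "DERIV s t :> inverse (1 / k (s t))"
    proof (rule DERIV_inverse_function[where f = T and a = "-\<delta>" and b = \<delta>])
      show "DERIV T (s t) :> 1 / k (s t)" using Td s t by auto
      show "1 / k (s t) \<noteq> 0" using pos[of "s t"] s[OF t] by auto
    qed (use t s sc in auto)
    then show "DERIV s t :> k (s t)" by simp
  next
    show "s 0 = 0" using sT[of 0] T00 d \<open>\<rho> > 0\<close> by auto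
  qed (use d s op in auto)
qed

text \<open>Arc length is taken with respect to the indefinite form \<open>ds\<^sup>2 - dw\<^sup>2\<close>, for which the curve is
  spacelike because \<open>2 \<bar>Gs\<bar> \<le> Gw\<close>.\<close>

lemma unit_speed_zero_set:
  fixes G Gs Gw :: "real \<Rightarrow> real \<Rightarrow> real"
  assumes ds: "\<And>s w. ((\<lambda>s. G s w) has_real_derivative Gs s w) (at s)"
    and dw: "\<And>s w. ((\<lambda>w. G s w) has_real_derivative Gw s w) (at w)"
    and cs: "continuous_on UNIV (\<lambda>(s, w). Gs s w)"
    and cw: "continuous_on UNIV (\<lambda>(s, w). Gw s w)"
    and G0: "G 0 0 = 0" "Gs 0 0 = 0" "Gw 0 0 = 1" and "R > 0"
  obtains r \<delta> s w where "0 < r" "r \<le> R" "0 < \<delta>" "s 0 = 0" "w 0 = 0" "open (s ` {-\<delta><..<\<delta>})"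
    "\<And>t. \<bar>t\<bar> < \<delta> \<Longrightarrow> \<bar>s t\<bar> < r \<and> \<bar>w t\<bar> < r"
    "\<And>t \<omega>. \<bar>t\<bar> < \<delta> \<Longrightarrow> \<bar>\<omega>\<bar> < r \<Longrightarrow> G (s t) \<omega> = 0 \<longleftrightarrow> \<omega> = w t"
    "\<And>t. \<bar>t\<bar> < \<delta> \<Longrightarrow> \<bar>w t\<bar> \<le> 2 * \<bar>G (s t) 0\<bar>"
    "\<And>t. \<bar>t\<bar> < \<delta> \<Longrightarrow> 0 < Gw (s t) (w t) \<and> 2 * \<bar>Gs (s t) (w t)\<bar> \<le> Gw (s t) (w t)"
    "\<And>t. \<bar>t\<bar> < \<delta> \<Longrightarrow> (s has_real_derivative
        Gw (s t) (w t) / sqrt ((Gw (s t) (w t))\<^sup>2 - (Gs (s t) (w t))\<^sup>2)) (at t)"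
    "\<And>t. \<bar>t\<bar> < \<delta> \<Longrightarrow> (w has_real_derivative
        - Gs (s t) (w t) / sqrt ((Gw (s t) (w t))\<^sup>2 - (Gs (s t) (w t))\<^sup>2)) (at t)"
proof -
  obtain r f where r: "0 < r" "r \<le> R" and f0: "f 0 = 0"
    and box: "\<And>s w. \<bar>s\<bar> \<le> r \<Longrightarrow> \<bar>w\<bar> \<le> r \<Longrightarrow> \<bar>Gs s w\<bar> < 1/4 \<and> 1/2 < Gw s w"
    and f: "\<And>s. \<bar>s\<bar> \<le> r \<Longrightarrow> \<bar>f s\<bar> < r \<and> G s (f s) = 0"
    and uniq: "\<And>s w. \<bar>s\<bar> \<le> r \<Longrightarrow> \<bar>w\<bar> \<le> r \<Longrightarrow> G s w = 0 \<Longrightarrow> w = f s"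
    and fb: "\<And>s. \<bar>s\<bar> \<le> r \<Longrightarrow> \<bar>f s\<bar> \<le> 2 * \<bar>G s 0\<bar>"
    and fd: "\<And>s. \<bar>s\<bar> < r \<Longrightarrow> (f has_real_derivative - Gs s (f s) / Gw s (f s)) (at s)"
    by (rule implicit_function_box[OF assms]) (rule that)
  \<comment> \<open>On the graph dw/ds = - Gs / Gw, so the unit speed condition (ds/dt)^2 -
    (dw/dt)^2 = 1 gives ds/dt = \<open>k s\<close>.\<close>
  define k where "k s = Gw s (f s) / sqrt ((Gw s (f s))\<^sup>2 - (Gs s (f s))\<^sup>2)" for s
  have q: "(Gw s (f s))\<^sup>2 - (Gs s (f s))\<^sup>2 > 0" "Gw s (f s) > 0" "2 * \<bar>Gs s (f s)\<bar> \<le> Gw s (f s)"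
    if "\<bar>s\<bar> \<le> r" for s
  proof -
    have b: "\<bar>Gs s (f s)\<bar> < 1/4 \<and> 1/2 < Gw s (f s)" using box f that by force
    then show "Gw s (f s) > 0" "2 * \<bar>Gs s (f s)\<bar> \<le> Gw s (f s)" by auto
    have "\<not> \<bar>Gw s (f s)\<bar> \<le> \<bar>Gs s (f s)\<bar>" using b by auto
    then show "(Gw s (f s))\<^sup>2 - (Gs s (f s))\<^sup>2 > 0" by (simp add: abs_le_square_iff)
  qed
  \<comment> \<open>Differentiability of \<open>f\<close> is known for |s| < r only, so the equation
    for s is solved over a closed interval of half the radius.\<close>
  have fc: "continuous_on {-(r/2)..r/2} f"
    by (rule DERIV_continuous_on[OF has_field_derivative_at_within[OF fd]]) (use r in auto)
  have "continuous_on {-(r/2)..r/2} (\<lambda>s. case (s, f s) of (s, w) \<Rightarrow> Gs s w)"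
    "continuous_on {-(r/2)..r/2} (\<lambda>s. case (s, f s) of (s, w) \<Rightarrow> Gw s w)"
    by (rule continuous_on_compose2[OF cs] continuous_on_compose2[OF cw], intro continuous_intros fc, simp)+
  then have gc: "continuous_on {-(r/2)..r/2} (\<lambda>s. Gs s (f s))" "continuous_on {-(r/2)..r/2} (\<lambda>s. Gw s (f s))"
    by simp_all
  have kc: "continuous_on {-(r/2)..r/2} k"
    unfolding k_def using q(1) r by (intro continuous_intros gc) (auto simp: less_le)
  have kp: "k x > 0" if "\<bar>x\<bar> \<le> r / 2" for x
    using q[of x] that r unfolding k_def by (intro divide_pos_pos) auto
  have "r / 2 > 0" using r by simp
  from autonomous_ode_local[OF this kc kp]
  obtain \<delta> s where \<delta>: "\<delta> > 0" and s0: "s 0 = 0" and sb: "\<And>t. \<bar>t\<bar> < \<delta> \<Longrightarrow> \<bar>s t\<bar> < r / 2"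
    and sd: "\<And>t. \<bar>t\<bar> < \<delta> \<Longrightarrow> (s has_real_derivative k (s t)) (at t)" and so: "open (s ` {-\<delta><..<\<delta>})"
    by blast
  have sr: "\<bar>s t\<bar> \<le> r" "\<bar>s t\<bar> < r" if "\<bar>t\<bar> < \<delta>" for t using sb[OF that] r by auto
  show thesis
  proof (rule that[of r \<delta> s "\<lambda>t. f (s t)"])
    fix t assume t: "\<bar>t\<bar> < \<delta>"
    have "((\<lambda>t. f (s t)) has_real_derivative - Gs (s t) (f (s t)) / Gw (s t) (f (s t)) * k (s t)) (at t)"
      by (rule DERIV_chain2[OF fd[OF sr(2)[OF t]] sd[OF t]])
    then show "((\<lambda>t. f (s t)) has_real_derivative
        - Gs (s t) (f (s t)) / sqrt ((Gw (s t) (f (s t)))\<^sup>2 - (Gs (s t) (f (s t)))\<^sup>2)) (at t)"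
      using q(2)[OF sr(1)[OF t]] by (simp add: k_def)
    show "G (s t) \<omega> = 0 \<longleftrightarrow> \<omega> = f (s t)" if "\<bar>\<omega>\<bar> < r" for \<omega>
      using uniq[OF sr(1)[OF t], of \<omega>] f[OF sr(1)[OF t]] that by auto
  qed (use r \<delta> s0 f0 so sr f fb q sd k_def in auto)
qed

subsection \<open>Geodesics of a flat space\<close>

lemma geodesic_imp_line:
  assumes "geodesic \<gamma>" "\<gamma> 0 = p" "vector_derivative \<gamma> (at 0) = u"
  shows "\<gamma> t = p + t *\<^sub>R u"
proof -
  from assms(1) obtain D where D: "deriv_seq UNIV D" "\<And>t. D 0 t = \<gamma> t"
    unfolding geodesic_def smooth_curve_on_iff_deriv_seq[OF open_UNIV] by auto
  note nth = deriv_seq_nth_vector_derivative[OF D(1) open_UNIV D(2) UNIV_I]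
  have "D 2 t = 0" for t
    using assms(1) nth[of 2 t] by (simp add: geodesic_def)
  then have "(D 1 has_vector_derivative 0) (at t)" for t
    using deriv_seqD[OF D(1), of t 1] by (simp add: numeral_2_eq_2)
  then obtain c where c: "\<And>t. D 1 t = c"
    using has_vector_derivative_zero_constant[of UNIV "D 1"] by auto
  have "c = u"
    using nth[of 1 0] assms(3) c by (simp add: nth_vector_derivative_simps)
  have "((\<lambda>t. D 0 t - t *\<^sub>R u) has_vector_derivative 0) (at t)" for t
    using deriv_seqD[OF D(1), of t 0] c \<open>c = u\<close> by (auto intro!: derivative_eq_intros)
  then obtain k where "\<And>t. D 0 t - t *\<^sub>R u = k"
    using has_vector_derivative_zero_constant[of UNIV "\<lambda>t. D 0 t - t *\<^sub>R u"] by auto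
  from this[of 0] this[of t] show ?thesis
    using assms(2) D(2) by (simp add: algebra_simps)
qed

lemma geodesic_line:
  "geodesic (\<lambda>t. p + t *\<^sub>R u)"
proof -
  define D where "D r t = (case r of 0 \<Rightarrow> p + t *\<^sub>R u | Suc 0 \<Rightarrow> u | _ \<Rightarrow> 0)" for r t
  have D: "deriv_seq UNIV D"
    unfolding deriv_seq_def
  proof (intro allI ballI)
    fix r t
    show "(D r has_vector_derivative D (Suc r) t) (at t)"
      by (cases r; cases "r - 1")
        (auto simp: D_def[abs_def] intro!: derivative_eq_intros)
  qed
  have D0: "D 0 t = p + t *\<^sub>R u" for t by (simp add: D_def)
  show ?thesis
    unfolding geodesic_def smooth_curve_on_iff_deriv_seq[OF open_UNIV]
    using D D0 deriv_seq_nth_vector_derivative[OF D open_UNIV D0 UNIV_I, of 2]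
    by (auto simp: D_def numeral_2_eq_2)
qed

subsection \<open>The surface as an orbit\<close>

lemma vector_8 [simp]:
  fixes x1 x2 x3 x4 x5 x6 x7 x8 :: real
  defines "z \<equiv> vector [x1, x2, x3, x4, x5, x6, x7, x8] :: real^8"
  shows "z $ 1 = x1" "z $ 2 = x2" "z $ 3 = x3" "z $ 4 = x4"
    "z $ 5 = x5" "z $ 6 = x6" "z $ 7 = x7" "z $ 8 = x8"
  unfolding z_def vector_def by simp_all

lemma exhaust_8:
  fixes i :: 8
  shows "i = 1 \<or> i = 2 \<or> i = 3 \<or> i = 4 \<or> i = 5 \<or> i = 6 \<or> i = 7 \<or> i = 8"
proof (induct i)
  case (of_int z)
  \<comment> \<open>The representatives run from 0 to 7, and the residue 0 is the element written
    8.\<close>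
  then have "z = 0 \<or> z = 1 \<or> z = 2 \<or> z = 3 \<or> z = 4 \<or> z = 5 \<or> z = 6 \<or> z = 7" by fastforce
  then show ?case by auto
qed

lemma forall_8:
  "(\<forall>i::8. P i) \<longleftrightarrow> P 1 \<and> P 2 \<and> P 3 \<and> P 4 \<and> P 5 \<and> P 6 \<and> P 7 \<and> P 8"
proof
  assume P: "P 1 \<and> P 2 \<and> P 3 \<and> P 4 \<and> P 5 \<and> P 6 \<and> P 7 \<and> P 8"
  show "\<forall>i. P i"
  proof
    fix i show "P i"
      using exhaust_8[of i] P by (elim disjE) simp_all
  qed
qed simp

lemma vec_eq_8:
  fixes x y :: "real^8"
  shows "x = y \<longleftrightarrow> x$1 = y$1 \<and> x$2 = y$2 \<and> x$3 = y$3 \<and> x$4 = y$4 \<and>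
    x$5 = y$5 \<and> x$6 = y$6 \<and> x$7 = y$7 \<and> x$8 = y$8"
  by (simp add: vec_eq_iff forall_8)

lemma has_derivative_vec:
  fixes f :: "'a::real_normed_vector \<Rightarrow> real^'n"
  shows "(f has_derivative f') (at p) \<longleftrightarrow>
    (\<forall>i. ((\<lambda>x. f x $ i) has_derivative (\<lambda>h. f' h $ i)) (at p))"
  by (subst has_derivative_componentwise_within) (auto simp: Basis_vec_def inner_axis)

lemma Phi_nth:
  "Phi a b p $ 1 = cos (a * p$1) * cosh (b * p$2) / sqrt 2"
  "Phi a b p $ 2 = sin (a * p$1) * cosh (b * p$2) / sqrt 2"
  "Phi a b p $ 3 = sin (a * p$1) * sinh (b * p$2) / sqrt 2"
  "Phi a b p $ 4 = cos (a * p$1) * sinh (b * p$2) / sqrt 2"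
  "Phi a b p $ 5 = cos (b * p$1) * cosh (a * p$2) / sqrt 2"
  "Phi a b p $ 6 = sin (b * p$1) * cosh (a * p$2) / sqrt 2"
  "Phi a b p $ 7 = sin (b * p$1) * sinh (a * p$2) / sqrt 2"
  "Phi a b p $ 8 = cos (b * p$1) * sinh (a * p$2) / sqrt 2"
  unfolding Phi_def Theta_def append.simps vector_scaleR_component vector_8 by simp_all

lemma Phi_scaled: "Phi a b p = (1 / sqrt 2) *\<^sub>R vector
    [cos (a * p$1) * cosh (b * p$2), sin (a * p$1) * cosh (b * p$2),
     sin (a * p$1) * sinh (b * p$2), cos (a * p$1) * sinh (b * p$2),
     cos (b * p$1) * cosh (a * p$2), sin (b * p$1) * cosh (a * p$2),
     sin (b * p$1) * sinh (a * p$2), cos (b * p$1) * sinh (a * p$2)]"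
  by (simp add: Phi_def Theta_def)

text \<open>\<open>\<Phi>\<close> is an orbit of a two-parameter group of linear isometries of \<open>\<real>\<^sup>8\<close>, with generator
  \<open>inf_gen a b v\<close> in the direction \<open>v\<close>.\<close>

definition inf_gen :: "real \<Rightarrow> real \<Rightarrow> real^2 \<Rightarrow> real^8 \<Rightarrow> real^8" where
  "inf_gen a b v z = vector
    [b * v$2 * z$4 - a * v$1 * z$2, a * v$1 * z$1 + b * v$2 * z$3,
     a * v$1 * z$4 + b * v$2 * z$2, b * v$2 * z$1 - a * v$1 * z$3,
     a * v$2 * z$8 - b * v$1 * z$6, b * v$1 * z$5 + a * v$2 * z$7,
     b * v$1 * z$8 + a * v$2 * z$6, a * v$2 * z$5 - b * v$1 * z$7]"

lemma bilinear_inf_gen: "bilinear (inf_gen a b)"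
  unfolding bilinear_def
  by (auto intro!: linearI simp: inf_gen_def vec_eq_8 algebra_simps)

lemma bounded_bilinear_inf_gen: "bounded_bilinear (inf_gen a b)"
  using bilinear_inf_gen by (simp add: bilinear_conv_bounded_bilinear)

lemma bounded_linear_inf_gen: "bounded_linear (inf_gen a b v)"
  by (rule bounded_bilinear.bounded_linear_right[OF bounded_bilinear_inf_gen])

text \<open>The linear differential equation of the orbit, by which every further differentiation of
  \<open>Phi\<close> becomes the application of a linear map.\<close>

lemma Phi_has_derivative:
  "(Phi a b has_derivative (\<lambda>v. inf_gen a b v (Phi a b p))) (at p)"
proof -
  have d1: "((\<lambda>x::real^2. f (c * x $ 1)) has_derivative (\<lambda>h. c * h $ 1 * f')) (at p)"
    if "(f has_real_derivative f') (at (c * p $ 1))" for f f' c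
    by (rule DERIV_compose_FDERIV[where g = "\<lambda>x::real^2. c * x $ 1", OF that])
      (intro bounded_linear.has_derivative[OF bounded_linear_vec_nth] has_derivative_mult_right has_derivative_ident)
  have d2: "((\<lambda>x::real^2. f (c * x $ 2)) has_derivative (\<lambda>h. c * h $ 2 * f')) (at p)"
    if "(f has_real_derivative f') (at (c * p $ 2))" for f f' c
    by (rule DERIV_compose_FDERIV[where g = "\<lambda>x::real^2. c * x $ 2", OF that])
      (intro bounded_linear.has_derivative[OF bounded_linear_vec_nth] has_derivative_mult_right has_derivative_ident)
  have d: "((\<lambda>x::real^2. f (c * x $ 1) * g (d * x $ 2)) has_derivative
      (\<lambda>h. f (c * p $ 1) * (d * h $ 2 * g') + (c * h $ 1 * f') * g (d * p $ 2))) (at p)"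
    if "(f has_real_derivative f') (at (c * p $ 1))" "(g has_real_derivative g') (at (d * p $ 2))" for f f' g g' c d
    by (rule has_derivative_mult[OF d1 d2]) (fact that)+
  have cosh: "(cosh has_real_derivative sinh x) (at x)" and sinh: "(sinh has_real_derivative cosh x) (at x)" for x
    by (auto intro!: derivative_eq_intros)
  show ?thesis
    unfolding Phi_scaled bilinear_rmul[OF bilinear_inf_gen]
    by (rule has_derivative_scaleR_right, unfold has_derivative_vec forall_8 inf_gen_def vector_8,
      intro conjI; (rule has_derivative_eq_rhs, rule d, (rule DERIV_cos DERIV_sin cosh sinh)+,
        simp add: algebra_simps))
qed

lemma Phi_has_vector_derivative:
  assumes "(v has_vector_derivative v') (at t)"
  shows "((\<lambda>t. Phi a b (v t)) has_vector_derivative inf_gen a b v' (Phi a b (v t))) (at t)"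
  using has_derivative_compose[OF assms[unfolded has_vector_derivative_def] Phi_has_derivative]
  by (simp add: has_vector_derivative_def bilinear_lmul[OF bilinear_inf_gen])

lemma frechet_derivative_Phi:
  "frechet_derivative (Phi a b) (at p) = (\<lambda>v. inf_gen a b v (Phi a b p))"
  by (rule frechet_derivative_at[OF Phi_has_derivative, symmetric])

lemma continuous_on_Phi: "continuous_on S (Phi a b)"
  using has_derivative_continuous[OF Phi_has_derivative]
  by (blast intro: continuous_at_imp_continuous_on)

text \<open>The general \<open>L\<close> makes the induction close: a directional derivative of
  \<open>L\<close> after \<open>Phi\<close> is \<open>L\<close> composed with a generator, again a
  linear map after \<open>Phi\<close>.\<close>

lemma C_class_linear_Phi: "bounded_linear L \<Longrightarrow> C_class k (\<lambda>p. L (Phi a b p) :: real^8)"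
proof (induction k arbitrary: L)
  case 0
  then show ?case
    unfolding C_class.simps by (rule bounded_linear.continuous_on[OF _ continuous_on_Phi])
next
  case (Suc k)
  have d: "((\<lambda>p. L (Phi a b p)) has_derivative (\<lambda>v. L (inf_gen a b v (Phi a b p)))) (at p)" for p
    by (rule bounded_linear.has_derivative[OF Suc.prems Phi_has_derivative])
  have "frechet_derivative (\<lambda>p. L (Phi a b p)) (at p) = (\<lambda>v. L (inf_gen a b v (Phi a b p)))" for p
    by (rule frechet_derivative_at[OF d, symmetric])
  moreover have "C_class k (\<lambda>p. L (inf_gen a b v (Phi a b p)))" for v
    by (rule Suc.IH[OF bounded_linear_compose[OF Suc.prems bounded_linear_inf_gen]])
  moreover have "(\<lambda>p. L (Phi a b p)) differentiable_on UNIV"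
    unfolding differentiable_on_def differentiable_def using d by blast
  ultimately show ?case
    by simp
qed

lemma smooth_map_Phi: "smooth_map (Phi a b)"
  using C_class_linear_Phi[OF bounded_linear_ident] by (simp add: smooth_map_def)

text \<open>The partial derivatives of \<open>K(x, y) = \<langle>\<Phi>(p + (x, y)), \<Phi>(p)\<rangle>\<close> are \<open>- pair_x\<close> and \<open>pair_y\<close>.\<close>

definition pair_x :: "real \<Rightarrow> real \<Rightarrow> real \<Rightarrow> real \<Rightarrow> real" where
  "pair_x a b x y = (a * sin (a * x) * cosh (b * y) + b * sin (b * x) * cosh (a * y)) / 2"

definition pair_y :: "real \<Rightarrow> real \<Rightarrow> real \<Rightarrow> real \<Rightarrow> real" where
  "pair_y a b x y = (b * cos (a * x) * sinh (b * y) + a * cos (b * x) * sinh (a * y)) / 2"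

lemma bilinear_metric_E84: "bilinear metric_E84"
  unfolding bilinear_def
  by (auto intro!: linearI simp: metric_E84_def algebra_simps)

lemma bounded_linear_metric_E84: "bounded_linear (\<lambda>z. metric_E84 z w)"
  by (rule bounded_bilinear.bounded_linear_left[OF bilinear_metric_E84[unfolded bilinear_conv_bounded_bilinear]])

lemmas metric_E84_linear =
  bilinear_ladd[OF bilinear_metric_E84] bilinear_lsub[OF bilinear_metric_E84]
  bilinear_lmul[OF bilinear_metric_E84]
  bilinear_rmul[OF bilinear_metric_E84]

text \<open>The addition theorems leave functions of q - p alone. Since the second argument of the
  pairing is the one varied, the value is minus the derivative of \<open>K\<close> at q - p in the
  direction \<open>e\<close>.\<close>

lemma metric_Phi_inf_gen:
  "metric_E84 (Phi a b q) (inf_gen a b e (Phi a b p)) =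
    e$1 * pair_x a b (q$1 - p$1) (q$2 - p$2) - e$2 * pair_y a b (q$1 - p$1) (q$2 - p$2)"
proof -
  have "2 * metric_E84 (Phi a b q) (inf_gen a b e (Phi a b p)) =
    e$1 * (2 * pair_x a b (q$1 - p$1) (q$2 - p$2)) - e$2 * (2 * pair_y a b (q$1 - p$1) (q$2 - p$2))"
    unfolding Phi_scaled bilinear_rmul[OF bilinear_inf_gen] metric_E84_linear
    unfolding metric_E84_def inf_gen_def vector_8 pair_x_def pair_y_def right_diff_distrib
      sin_diff cos_diff cosh_diff sinh_diff
    by (simp add: field_simps)
  then show ?thesis by (simp add: algebra_simps)
qed

text \<open>Mixed terms cancel inside each block of four coordinates. The blocks leave the diagonal
  forms with coefficients a^2, -b^2 and b^2, -a^2, whose half-sum is the Lorentz metric.\<close>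

lemma metric_inf_gen:
  assumes ab: "a\<^sup>2 + b\<^sup>2 = 2"
  shows "metric_E84 (inf_gen a b u (Phi a b p)) (inf_gen a b v (Phi a b p)) = metric_E21 u v"
proof -
  define C S c s where "C = cosh (b * p$2)" and "S = sinh (b * p$2)"
    and "c = cos (a * p$1)" and "s = sin (a * p$1)"
  define C' S' c' s' where "C' = cosh (a * p$2)" and "S' = sinh (a * p$2)"
    and "c' = cos (b * p$1)" and "s' = sin (b * p$1)"
  note defs = C_def S_def c_def s_def C'_def S'_def c'_def s'_def
  have id: "C\<^sup>2 - S\<^sup>2 = 1" "s\<^sup>2 + c\<^sup>2 = 1" "C'\<^sup>2 - S'\<^sup>2 = 1" "s'\<^sup>2 + c'\<^sup>2 = 1"
    unfolding defs by (simp_all add: hyperbolic_pythagoras)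
  have "2 * metric_E84 (inf_gen a b u (Phi a b p)) (inf_gen a b v (Phi a b p)) =
    (a\<^sup>2 * u$1 * v$1 - b\<^sup>2 * u$2 * v$2) * ((C\<^sup>2 - S\<^sup>2) * (s\<^sup>2 + c\<^sup>2)) +
    (b\<^sup>2 * u$1 * v$1 - a\<^sup>2 * u$2 * v$2) * ((C'\<^sup>2 - S'\<^sup>2) * (s'\<^sup>2 + c'\<^sup>2))"
    unfolding Phi_scaled defs[symmetric] bilinear_rmul[OF bilinear_inf_gen] metric_E84_linear
    unfolding metric_E84_def inf_gen_def vector_8
    by (simp add: algebra_simps power2_eq_square)
  also have "\<dots> = (a\<^sup>2 + b\<^sup>2) * metric_E21 u v"
    unfolding id by (simp add: metric_E21_def algebra_simps)
  finally show ?thesis using ab by simp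
qed

text \<open>The reflection in the diagonal: an anti-isometry of the Lorentz metric taking each
  vector to an orthogonal one.\<close>

definition conj_vec :: "real^2 \<Rightarrow> real^2" where
  "conj_vec u = vector [u$2, u$1]"

lemma conj_vec_nth [simp]: "conj_vec u $ 1 = u$2" "conj_vec u $ 2 = u$1"
  by (simp_all add: conj_vec_def)

text \<open>Expansion in an orthogonal basis; the minus sign reflects that \<open>conj_vec u\<close>
  has the opposite square of \<open>u\<close>.\<close>

lemma conj_vec_decomp:
  assumes "metric_E21 u u \<noteq> 0"
  shows "v = (metric_E21 v u / metric_E21 u u) *\<^sub>R u - (metric_E21 v (conj_vec u) / metric_E21 u u) *\<^sub>R conj_vec u"
proof -
  define n where "n = metric_E21 u u"
  have n: "n = u$1 * u$1 - u$2 * u$2" "n \<noteq> 0" using assms by (auto simp: n_def metric_E21_def)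
  have "v$1 = (metric_E21 v u * u$1 - metric_E21 v (conj_vec u) * u$2) / n"
    "v$2 = (metric_E21 v u * u$2 - metric_E21 v (conj_vec u) * u$1) / n"
    by (rule nonzero_eq_divide_eq[OF n(2), THEN iffD2], simp add: n(1) metric_E21_def algebra_simps)+
  then show ?thesis
    unfolding n_def[symmetric] by (simp add: vec_eq_iff forall_2 diff_divide_distrib)
qed

text \<open>The relation \<open>ab_sum\<close> makes the immersion isometric. With
  \<open>ab_prod\<close> it gives (a^2 - b^2)^2 = 2 and (a b)^2 = 1/2, the values behind the
  cancellations below order seven.\<close>

locale flat_surface =
  fixes a b :: real
  assumes ab_sum: "a\<^sup>2 + b\<^sup>2 = 2" and ab_prod: "a\<^sup>2 * b\<^sup>2 = 1 / 2" and ab_pos: "0 < a" "0 < b"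
begin

lemma metric_inf_gen_inf_gen [simp]:
  "metric_E84 (inf_gen a b u (Phi a b p)) (inf_gen a b v (Phi a b p)) = metric_E21 u v"
  by (rule metric_inf_gen[OF ab_sum])

lemma isometric_immersion_Phi: "isometric_immersion metric_E21 metric_E84 (Phi a b)"
  unfolding isometric_immersion_def frechet_derivative_Phi
proof (intro conjI allI smooth_map_Phi)
  fix p
  show "inj (\<lambda>v. inf_gen a b v (Phi a b p))"
  proof (rule injI)
    fix u v assume eq: "inf_gen a b u (Phi a b p) = inf_gen a b v (Phi a b p)"
    have "metric_E21 u e = metric_E21 v e" for e
      using metric_inf_gen_inf_gen[of u p e] metric_inf_gen_inf_gen[of v p e] eq by simp
    from this[of "vector [1, 0]"] this[of "vector [0, 1]"] show "u = v"
      by (simp add: metric_E21_def vec_eq_iff forall_2)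
  qed
qed simp

text \<open>The images of \<open>u\<close> and \<open>conj_vec u\<close> are an orthogonal basis of
  the nondegenerate tangent plane. Once the component along \<open>u\<close> is split off, normality
  of the remainder is the single condition of orthogonality to the image of
  \<open>conj_vec u\<close>.\<close>

lemma section_space_Phi:
  assumes "metric_E21 u u \<noteq> 0"
  shows "z \<in> section_space metric_E84 (Phi a b) p u \<longleftrightarrow>
    metric_E84 (z - Phi a b p) (inf_gen a b (conj_vec u) (Phi a b p)) = 0"
proof
  assume "z \<in> section_space metric_E84 (Phi a b) p u"
  then obtain s w where "z = Phi a b p + s *\<^sub>R inf_gen a b u (Phi a b p) + w"
    and "\<forall>v. metric_E84 w (inf_gen a b v (Phi a b p)) = 0"
    unfolding section_space_def normal_space_def frechet_derivative_Phi by blast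
  then show "metric_E84 (z - Phi a b p) (inf_gen a b (conj_vec u) (Phi a b p)) = 0"
    by (simp add: metric_E84_linear) (simp add: metric_E21_def)
next
  assume 0: "metric_E84 (z - Phi a b p) (inf_gen a b (conj_vec u) (Phi a b p)) = 0"
  define s where "s = metric_E84 (z - Phi a b p) (inf_gen a b u (Phi a b p)) / metric_E21 u u"
  define w where "w = z - Phi a b p - s *\<^sub>R inf_gen a b u (Phi a b p)"
  have w: "metric_E84 w (inf_gen a b u (Phi a b p)) = 0"
    "metric_E84 w (inf_gen a b (conj_vec u) (Phi a b p)) = 0"
    using assms 0
    by (simp_all add: w_def metric_E84_linear s_def) (simp add: metric_E21_def)
  have "metric_E84 w (inf_gen a b v (Phi a b p)) = 0" for v
    by (subst conj_vec_decomp[OF assms, of v])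
      (simp add: bilinear_lsub[OF bilinear_inf_gen] bilinear_lmul[OF bilinear_inf_gen]
        bilinear_rsub[OF bilinear_metric_E84] metric_E84_linear w)
  then have "w \<in> normal_space metric_E84 (Phi a b) p"
    unfolding normal_space_def frechet_derivative_Phi by blast
  then show "z \<in> section_space metric_E84 (Phi a b) p u"
    unfolding section_space_def frechet_derivative_Phi
    by (intro CollectI exI[of _ s] exI[of _ w]) (simp add: w_def)
qed

text \<open>The first four coordinates suffice: sinh (2 b y) is a quadratic expression in them,
  which determines y; then cos (a x) and sin (a x) are determined, hence a x modulo 2 pi. Since a <
  2, first components at distance at most 1 leave only the zero multiple.\<close>

lemma Phi_locally_inj:
  assumes "Phi a b p = Phi a b q" "\<bar>p$1 - q$1\<bar> \<le> 1"
  shows "p = q"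
proof -
  have a2: "a < 2"
  proof (rule ccontr)
    assume "\<not> a < 2"
    then have "2 * 2 \<le> a * a" by (intro mult_mono) auto
    then show False using ab_sum zero_le_square[of b] unfolding power2_eq_square by linarith
  qed
  have e: "cos (a * p$1) * cosh (b * p$2) = cos (a * q$1) * cosh (b * q$2)"
    "sin (a * p$1) * cosh (b * p$2) = sin (a * q$1) * cosh (b * q$2)"
    "sin (a * p$1) * sinh (b * p$2) = sin (a * q$1) * sinh (b * q$2)"
    "cos (a * p$1) * sinh (b * p$2) = cos (a * q$1) * sinh (b * q$2)"
    using assms(1) unfolding vec_eq_8 Phi_nth by auto
  have "sinh (2 * (b * p$2)) = 2 * ((sin (a * p$1) * sinh (b * p$2)) * (sin (a * p$1) * cosh (b * p$2)) +
      (cos (a * p$1) * sinh (b * p$2)) * (cos (a * p$1) * cosh (b * p$2)))"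
    using sin_cos_squared_add[of "a * p$1"] unfolding sinh_double by algebra
  also have "\<dots> = 2 * ((sin (a * q$1) * sinh (b * q$2)) * (sin (a * q$1) * cosh (b * q$2)) +
      (cos (a * q$1) * sinh (b * q$2)) * (cos (a * q$1) * cosh (b * q$2)))"
    unfolding e ..
  also have "\<dots> = sinh (2 * (b * q$2))"
    using sin_cos_squared_add[of "a * q$1"] unfolding sinh_double by algebra
  finally have y: "p$2 = q$2" using ab_pos by simp
  have sc: "cos (a * p$1) = cos (a * q$1)" "sin (a * p$1) = sin (a * q$1)"
    using e(1,2) by (simp_all add: y)
  have "cos (a * p$1 - a * q$1) = 1"
    unfolding cos_diff sc using sin_cos_squared_add[of "a * q$1"] by algebra
  then obtain n :: int where n: "a * p$1 - a * q$1 = n * (2 * pi)"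
    using cos_one_2pi_int by (metis mult.commute mult.left_commute)
  have "\<bar>a * p$1 - a * q$1\<bar> = a * \<bar>p$1 - q$1\<bar>"
    using ab_pos by (simp add: abs_mult right_diff_distrib[symmetric])
  also have "\<dots> \<le> 2 * 1" using a2 ab_pos assms(2) by (intro mult_mono) auto
  finally have le: "\<bar>of_int n\<bar> * (2 * pi) \<le> 2"
    unfolding n by (simp add: abs_mult)
  have "n = 0"
  proof (rule ccontr)
    assume "n \<noteq> 0"
    then have "1 * (2 * 3) \<le> \<bar>of_int n :: real\<bar> * (2 * pi)"
      using pi_gt3 by (intro mult_mono) auto
    with le show False by simp
  qed
  then have "a * (p$1 - q$1) = 0" using n by (simp add: algebra_simps)
  then have "p$1 = q$1" using ab_pos by simp
  with y show ?thesis by (simp add: vec_eq_iff forall_2)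
qed

lemma Phi_line_deriv_seq:
  "deriv_seq UNIV (\<lambda>r t. (inf_gen a b u ^^ r) (Phi a b (p + t *\<^sub>R u)))"
  unfolding deriv_seq_def
proof (intro allI ballI)
  fix r t
  have bl: "bounded_linear (inf_gen a b u ^^ r)"
  proof (induction r)
    case (Suc r)
    then show ?case using bounded_linear_compose[OF bounded_linear_inf_gen Suc] by (simp add: o_def)
  qed (simp add: id_def bounded_linear_ident)
  have "((\<lambda>t. p + t *\<^sub>R u) has_vector_derivative u) (at t)"
    by (auto intro!: derivative_eq_intros)
  from Phi_has_vector_derivative[OF this]
  have "((\<lambda>t. Phi a b (p + t *\<^sub>R u)) has_vector_derivative inf_gen a b u (Phi a b (p + t *\<^sub>R u))) (at t)" .
  from bounded_linear.has_vector_derivative[OF bl this]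
  show "((\<lambda>t. (inf_gen a b u ^^ r) (Phi a b (p + t *\<^sub>R u))) has_vector_derivative
      (inf_gen a b u ^^ Suc r) (Phi a b (p + t *\<^sub>R u))) (at t)"
    by (simp add: funpow_swap1)
qed

end

subsection \<open>The section equation along a line\<close>

text \<open>Functions such as \<open>cos (p s) sinh (q s)\<close> are real and imaginary parts of \<open>sinh (s (q + i p))\<close>.\<close>

definition sinh_seq :: "complex \<Rightarrow> nat \<Rightarrow> real \<Rightarrow> complex" where
  "sinh_seq z r s = z ^ r * (exp (of_real s * z) - (- 1) ^ r * exp (- (of_real s * z))) / 2"

lemma deriv_seq_sinh_seq: "deriv_seq I (sinh_seq z)"
  unfolding deriv_seq_def
proof (intro allI ballI)
  fix r t
  have e: "((\<lambda>s. exp (of_real s * w)) has_vector_derivative w * exp (of_real t * w)) (at t)" for w :: complex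
    by (auto intro!: derivative_eq_intros has_vector_derivative_real_field)
  have "((\<lambda>s. (z ^ r / 2) * (exp (of_real s * z) - (- 1) ^ r * exp (of_real s * (- z)))) has_vector_derivative
      (z ^ r / 2) * (z * exp (of_real t * z) - (- 1) ^ r * (- z * exp (of_real t * (- z))))) (at t)"
    by (intro has_vector_derivative_mult_right has_vector_derivative_diff e)
  then show "(sinh_seq z r has_vector_derivative sinh_seq z (Suc r) t) (at t)"
    by (simp add: sinh_seq_def[abs_def] algebra_simps add_divide_distrib diff_divide_distrib)
qed

lemma sinh_seq_0:
  "sinh_seq z r 0 = (if odd r then z ^ r else 0)"
  by (simp add: sinh_seq_def)

lemma sinh_seq_Complex:
  "Re (sinh_seq (Complex q p) 0 s) = cos (p * s) * sinh (q * s)"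
  "Im (sinh_seq (Complex q p) 0 s) = sin (p * s) * cosh (q * s)"
  by (simp_all add: sinh_seq_def Re_exp Im_exp sinh_field_def cosh_field_def algebra_simps
      add_divide_distrib diff_divide_distrib)

context flat_surface
begin

text \<open>Minus the derivative of \<open>K\<close> in the direction
  \<open>conj_vec u\<close>.\<close>

definition section_eq :: "real^2 \<Rightarrow> real \<Rightarrow> real \<Rightarrow> real" where
  "section_eq u x y = u$2 * pair_x a b x y - u$1 * pair_y a b x y"

lemma metric_Phi_conj_vec:
  "metric_E84 (Phi a b q) (inf_gen a b (conj_vec u) (Phi a b p)) = section_eq u (q$1 - p$1) (q$2 - p$2)"
  by (simp add: metric_Phi_inf_gen section_eq_def)

lemma section_eq_0 [simp]: "section_eq u 0 0 = 0"
  by (simp add: section_eq_def pair_x_def pair_y_def)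

lemma section_space_Phi_iff:
  assumes "metric_E21 u u \<noteq> 0"
  shows "Phi a b q \<in> section_space metric_E84 (Phi a b) p u \<longleftrightarrow> section_eq u (q$1 - p$1) (q$2 - p$2) = 0"
  unfolding section_space_Phi[OF assms] bilinear_lsub[OF bilinear_metric_E84] metric_Phi_conj_vec by simp

text \<open>Along the line the function is - Re (\<zeta>1 sinh (s z1) + \<zeta>2 sinh (s z2)) / 2.
  It is odd in s, and its derivative of order 2j + 1 at 0 involves only \<zeta> z and the j-th power
  of z^2. One identity, n k = g h, cancels orders 1, 3 and 5 and reduces order 7 to 2 g h (h^2 +
  k^2).\<close>

lemma section_eq_line_deriv_seq:
  obtains D where "deriv_seq UNIV D" "\<And>s. D 0 s = section_eq u (s * u$1) (s * u$2)"
    "\<And>r. r < 7 \<Longrightarrow> D r 0 = 0"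
    "D 7 0 = u$1 * u$2 * ((u$1)\<^sup>2 + (u$2)\<^sup>2) * (((u$1)\<^sup>2 + (u$2)\<^sup>2)\<^sup>2 + 4 * (u$1)\<^sup>2 * (u$2)\<^sup>2)"
proof -
  define x y where "x = u$1" and "y = u$2"
  \<comment> \<open>\<open>z1\<close>, \<open>z2\<close> are the complex frequencies of
    \<open>sinh_seq_Complex\<close>; \<open>\<zeta>1\<close>, \<open>\<zeta>2\<close> collect the
    coefficients with which real and imaginary parts enter \<open>section_eq\<close>.\<close>
  define z1 z2 \<zeta>1 \<zeta>2 where "z1 = Complex (b * y) (a * x)" and "z2 = Complex (a * y) (b * x)"
    and "\<zeta>1 = Complex (b * x) (a * y)" and "\<zeta>2 = Complex (a * x) (b * y)"
  define D where "D r s = - Re (\<zeta>1 * sinh_seq z1 r s + \<zeta>2 * sinh_seq z2 r s) / 2" for r s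
  define c m where "c = a\<^sup>2 - b\<^sup>2" and "m = a * b"
  have "c\<^sup>2 = (a\<^sup>2 + b\<^sup>2)\<^sup>2 - 4 * (a\<^sup>2 * b\<^sup>2)"
    by (simp add: c_def power2_eq_square algebra_simps)
  then have c2: "c\<^sup>2 = 2"
    by (simp add: ab_sum ab_prod)
  have m2: "m\<^sup>2 = 1 / 2"
    using ab_prod by (simp add: m_def power_mult_distrib)
  \<comment> \<open>Real and imaginary parts of the squares z^2 and of the products \<zeta> z; the
    two frequencies differ only in the signs of \<open>h\<close> and \<open>g\<close>.\<close>
  define d h k g n where "d = y\<^sup>2 - x\<^sup>2" and "h = c / 2 * (x\<^sup>2 + y\<^sup>2)" and "k = 2 * m * x * y"
    and "g = c * x * y" and "n = m * (x\<^sup>2 + y\<^sup>2)"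
  have a2: "a\<^sup>2 = 1 + c / 2"
    using ab_sum by (simp add: c_def field_simps)
  have b2: "b\<^sup>2 = 1 - c / 2"
    using ab_sum by (simp add: c_def field_simps)
  have Z: "z1\<^sup>2 = Complex (d - h) k" "z2\<^sup>2 = Complex (d + h) k"
    "\<zeta>1 * z1 = Complex (- g) n" "\<zeta>2 * z2 = Complex g n"
  proof -
    have "(b * y)\<^sup>2 - (a * x)\<^sup>2 = d - h" "(a * y)\<^sup>2 - (b * x)\<^sup>2 = d + h"
      by (simp_all add: power_mult_distrib a2 b2 d_def h_def algebra_simps)
    then show "z1\<^sup>2 = Complex (d - h) k" "z2\<^sup>2 = Complex (d + h) k"
      by (simp_all add: z1_def z2_def complex_eq_iff k_def m_def power2_eq_square)
    show "\<zeta>1 * z1 = Complex (- g) n" "\<zeta>2 * z2 = Complex g n"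
      by (simp_all add: \<zeta>1_def \<zeta>2_def z1_def z2_def complex_eq_iff g_def n_def c_def m_def
          power2_eq_square algebra_simps)
  qed
  have "n * k = 2 * m\<^sup>2 * (x * y * (x\<^sup>2 + y\<^sup>2))" "g * h = c\<^sup>2 / 2 * (x * y * (x\<^sup>2 + y\<^sup>2))"
    by (simp_all add: n_def k_def g_def h_def power2_eq_square)
  \<comment> \<open>Both sides equal x y (x^2 + y^2), by the values of c^2 and m^2.\<close>
  then have gh: "n * k = g * h"
    by (simp add: c2 m2)
  have D0: "D r 0 = (if odd r then - Re (Complex (- g) n * Complex (d - h) k ^ (r div 2) +
      Complex g n * Complex (d + h) k ^ (r div 2)) / 2 else 0)" for r
  proof (cases "odd r")
    case True
    then obtain j where j: "r = 2 * j + 1" by (rule oddE)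
    have r: "\<zeta> * z ^ r = (\<zeta> * z) * (z\<^sup>2) ^ j" for \<zeta> z :: complex
      by (simp add: j power_mult)
    have "r div 2 = j" by (simp add: j)
    then show ?thesis
      using True by (simp only: D_def sinh_seq_0 if_True not_False_eq_True r Z)
  qed (simp add: D_def sinh_seq_0)
  show thesis
  proof (rule that[of D])
    have "bounded_linear (\<lambda>w. - Re (\<zeta> * w) / 2)" for \<zeta>
      by (intro bounded_linear_divide[THEN bounded_linear_compose] bounded_linear_minus
          bounded_linear_compose[OF bounded_linear_Re] bounded_linear_mult_right)
    note seq = deriv_seq_linear[OF this deriv_seq_sinh_seq]
    show "deriv_seq UNIV D"
    proof -
      have "D = (\<lambda>r s. - Re (\<zeta>1 * sinh_seq z1 r s) / 2 + - Re (\<zeta>2 * sinh_seq z2 r s) / 2)"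
        by (simp add: fun_eq_iff D_def add_divide_distrib diff_divide_distrib)
      then show ?thesis
        using deriv_seq_add[OF seq seq] by simp
    qed
    show "D 0 s = section_eq u (s * u$1) (s * u$2)" for s
      unfolding D_def section_eq_def pair_x_def pair_y_def
      by (simp add: z1_def z2_def sinh_seq_Complex \<zeta>1_def \<zeta>2_def x_def[symmetric] y_def[symmetric] field_simps)
    have ev: "D 1 0 = 0" "D 3 0 = 0" "D 5 0 = 0"
      unfolding D0 using gh by (simp_all add: power2_eq_square algebra_simps)
    show "D r 0 = 0" if "r < 7" for r
    proof (cases "odd r")
      case True
      then have "r = 1 \<or> r = 3 \<or> r = 5" using that by presburger
      then show ?thesis using ev by auto
    qed (simp add: D0)
    have "D 7 0 = 2 * g * h * (h\<^sup>2 + k\<^sup>2)"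
    proof -
      have "2 * D 7 0 = - (g * ((d + h) ^ 3 - 3 * (d + h) * k\<^sup>2 - (d - h) ^ 3 + 3 * (d - h) * k\<^sup>2)
          - (n * k) * (3 * (d - h)\<^sup>2 + 3 * (d + h)\<^sup>2 - 2 * k\<^sup>2))"
        unfolding D0 by (simp add: power3_eq_cube power2_eq_square field_simps)
      also have "\<dots> = 2 * (2 * g * h * (h\<^sup>2 + k\<^sup>2))"
        unfolding gh by (simp add: power3_eq_cube power2_eq_square algebra_simps)
      finally show ?thesis by simp
    qed
    also have "\<dots> = x * y * (x\<^sup>2 + y\<^sup>2) * ((x\<^sup>2 + y\<^sup>2)\<^sup>2 + 4 * x\<^sup>2 * y\<^sup>2)"
    proof -
      have "2 * g * h = c\<^sup>2 * x * y * (x\<^sup>2 + y\<^sup>2)" "h\<^sup>2 = c\<^sup>2 / 4 * (x\<^sup>2 + y\<^sup>2)\<^sup>2" "k\<^sup>2 = 4 * m\<^sup>2 * x\<^sup>2 * y\<^sup>2"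
        by (simp_all add: g_def h_def k_def power2_eq_square)
      then have "2 * g * h = 2 * (x * y * (x\<^sup>2 + y\<^sup>2))"
        "h\<^sup>2 + k\<^sup>2 = ((x\<^sup>2 + y\<^sup>2)\<^sup>2 + 4 * x\<^sup>2 * y\<^sup>2) / 2"
        by (simp_all only: c2 m2) simp_all
      then show ?thesis by (simp only:)
    qed
    finally show "D 7 0 = u$1 * u$2 * ((u$1)\<^sup>2 + (u$2)\<^sup>2) * (((u$1)\<^sup>2 + (u$2)\<^sup>2)\<^sup>2 + 4 * (u$1)\<^sup>2 * (u$2)\<^sup>2)"
      by (simp add: x_def y_def)
  qed
qed

lemma not_contact_at_7:
  assumes u: "metric_E21 u u \<noteq> 0" and "u$1 \<noteq> 0" "u$2 \<noteq> 0" and "7 \<le> k"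
  shows "\<not> contact_at metric_E21 metric_E84 (Phi a b) k p u"
proof
  assume "contact_at metric_E21 metric_E84 (Phi a b) k p u"
  then obtain \<gamma> \<beta> where \<gamma>: "geodesic \<gamma>" "\<gamma> 0 = p" "vector_derivative \<gamma> (at 0) = u"
    and \<beta>: "normal_section metric_E21 metric_E84 (Phi a b) p u \<beta>"
    and eq: "nth_vector_derivative 7 (Phi a b \<circ> \<gamma>) 0 = nth_vector_derivative 7 \<beta> 0"
    unfolding contact_at_def using \<open>7 \<le> k\<close> by blast
  \<comment> \<open>Pairing with \<open>w\<close> is constant on E(p, u), so it annihilates the
    derivatives of the section of positive order; along the geodesic it is \<open>section_eq\<close>
    on a line.\<close>
  define w where "w = inf_gen a b (conj_vec u) (Phi a b p)"
  note lin = bounded_linear_metric_E84[of w]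
  from \<beta> obtain U \<delta> where "\<delta> > 0" and sm: "smooth_curve_on {-\<delta><..<\<delta>} \<beta>"
    and img: "\<beta> ` {-\<delta><..<\<delta>} = connected_component_set
      (Phi a b ` U \<inter> section_space metric_E84 (Phi a b) p u) (Phi a b p)"
    unfolding normal_section_def by blast
  have o: "open {-\<delta><..<\<delta>}" and 0: "0 \<in> {-\<delta><..<\<delta>}" using \<open>\<delta> > 0\<close> by auto
  have \<beta>w: "metric_E84 (\<beta> t) w = metric_E84 (Phi a b p) w" if "t \<in> {-\<delta><..<\<delta>}" for t
  proof -
    have "\<beta> t \<in> section_space metric_E84 (Phi a b) p u"
      using that img connected_component_subset by blast
    then show ?thesis
      unfolding section_space_Phi[OF u] w_def bilinear_lsub[OF bilinear_metric_E84] by simp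
  qed
  obtain B where B: "deriv_seq {-\<delta><..<\<delta>} B" "\<And>t. t \<in> {-\<delta><..<\<delta>} \<Longrightarrow> B 0 t = \<beta> t"
    using sm unfolding smooth_curve_on_iff_deriv_seq[OF o] by blast
  have "metric_E84 (B 7 0) w = 0"
    using deriv_seq_unique[OF deriv_seq_linear[OF lin B(1)] deriv_seq_const o _ 0,
        of "metric_E84 (Phi a b p) w" 7] B(2) \<beta>w by simp
  then have \<beta>7: "metric_E84 (nth_vector_derivative 7 \<beta> 0) w = 0"
    using deriv_seq_nth_vector_derivative[OF B(1) o B(2) 0] by simp
  obtain D where D: "deriv_seq UNIV D" "\<And>s. D 0 s = section_eq u (s * u$1) (s * u$2)"
    "\<And>r. r < 7 \<Longrightarrow> D r 0 = 0"
    "D 7 0 = u$1 * u$2 * ((u$1)\<^sup>2 + (u$2)\<^sup>2) * (((u$1)\<^sup>2 + (u$2)\<^sup>2)\<^sup>2 + 4 * (u$1)\<^sup>2 * (u$2)\<^sup>2)"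
    by (rule section_eq_line_deriv_seq[of u]) (rule that)
  have \<gamma>l: "\<gamma> = (\<lambda>t. p + t *\<^sub>R u)"
    using geodesic_imp_line[OF \<gamma>] by blast
  have "D 7 0 = metric_E84 ((inf_gen a b u ^^ 7) (Phi a b (p + 0 *\<^sub>R u))) w"
    by (rule deriv_seq_unique[OF D(1) deriv_seq_linear[OF lin Phi_line_deriv_seq[of u p]] open_UNIV _ UNIV_I])
      (simp add: D(2) w_def metric_Phi_conj_vec)
  also have "(inf_gen a b u ^^ 7) (Phi a b (p + 0 *\<^sub>R u)) = nth_vector_derivative 7 (Phi a b \<circ> \<gamma>) 0"
    by (rule deriv_seq_nth_vector_derivative[OF Phi_line_deriv_seq open_UNIV _ UNIV_I, symmetric])
      (simp add: \<gamma>l)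
  finally have "D 7 0 = 0"
    using eq \<beta>7 by simp
  moreover have "(u$1)\<^sup>2 + (u$2)\<^sup>2 > 0" using assms(2) by (simp add: add_pos_nonneg)
  then have "((u$1)\<^sup>2 + (u$2)\<^sup>2)\<^sup>2 + 4 * (u$1)\<^sup>2 * (u$2)\<^sup>2 > 0"
    by (intro add_pos_nonneg) auto
  ultimately show False
    using assms(2,3) \<open>(u$1)\<^sup>2 + (u$2)\<^sup>2 > 0\<close> D(4) by simp
qed

end

subsection \<open>Normal sections\<close>

text \<open>The derivative is bounded by a multiple of the norm of \<open>Phi\<close>, which is
  bounded on the compact ball.\<close>

lemma Phi_lipschitz:
  obtains L where "0 \<le> L" "\<And>x y. x \<in> cball p 1 \<Longrightarrow> y \<in> cball p 1 \<Longrightarrow>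
    norm (Phi a b x - Phi a b y) \<le> L * norm (x - y)"
proof -
  obtain K where K: "0 \<le> K" "\<And>v z. norm (inf_gen a b v z) \<le> norm v * norm z * K"
    using bounded_bilinear.nonneg_bounded[OF bounded_bilinear_inf_gen] by blast
  have "bounded (Phi a b ` cball p 1)"
    by (intro compact_imp_bounded compact_continuous_image continuous_on_Phi compact_cball)
  then obtain M where M: "\<And>x. x \<in> cball p 1 \<Longrightarrow> norm (Phi a b x) \<le> M"
    unfolding bounded_iff by blast
  have "0 \<le> M" using order_trans[OF norm_ge_zero M[of p]] by simp
  show thesis
  proof (rule that[of "M * K"])
    show "0 \<le> M * K" using \<open>0 \<le> M\<close> K by simp
    fix x y assume xy: "x \<in> cball p 1" "y \<in> cball p 1"
    show "norm (Phi a b x - Phi a b y) \<le> M * K * norm (x - y)"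
    proof (rule differentiable_bound[OF convex_cball has_derivative_at_withinI[OF Phi_has_derivative] _ xy])
      fix z assume "z \<in> cball p 1"
      show "onorm (\<lambda>v. inf_gen a b v (Phi a b z)) \<le> M * K"
      proof (rule onorm_bound)
        fix v
        have "norm (inf_gen a b v (Phi a b z)) \<le> norm v * norm (Phi a b z) * K" by (rule K)
        also have "\<dots> \<le> norm v * M * K"
          using M[OF \<open>z \<in> cball p 1\<close>] K by (intro mult_right_mono mult_left_mono) auto
        finally show "norm (inf_gen a b v (Phi a b z)) \<le> M * K * norm v" by (simp add: mult_ac)
      qed (fact \<open>0 \<le> M * K\<close>)
    qed
  qed
qed

text \<open>The local Lipschitz bound carries agreement to order n from the parameter plane to the
  ambient space.\<close>

lemma flat_Phi:
  assumes fl: "flat n (\<lambda>t. v t - w t)" and "isCont v 0" "isCont w 0" "v 0 = p" "w 0 = p"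
  shows "flat n (\<lambda>t. Phi a b (v t) - Phi a b (w t))"
proof -
  obtain L where L: "0 \<le> L" "\<And>x y. x \<in> cball p 1 \<Longrightarrow> y \<in> cball p 1 \<Longrightarrow>
    norm (Phi a b x - Phi a b y) \<le> L * norm (x - y)"
    by (rule Phi_lipschitz[where p = p and a = a and b = b]) (rule that)
  have ev: "\<forall>\<^sub>F t in nhds 0. f t \<in> cball p 1" if "isCont f 0" "f 0 = p" for f
  proof -
    have "(f \<longlongrightarrow> p) (nhds 0)" using that unfolding isCont_def tendsto_at_iff_tendsto_nhds by simp
    then have "\<forall>\<^sub>F t in nhds 0. dist (f t) p < 1" by (rule tendstoD) simp
    then show ?thesis by eventually_elim (simp add: dist_commute)
  qed
  have "\<forall>\<^sub>F t in nhds 0. norm (Phi a b (v t) - Phi a b (w t)) \<le> L * norm (v t - w t)"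
    using ev[OF assms(2,4)] ev[OF assms(3,5)] by eventually_elim (rule L(2))
  then show ?thesis by (rule flat_dominated[OF fl _ L(1)])
qed

lemma Phi_nth_alg:
  assumes "trig_gens X Y \<subseteq> H" "\<And>t. v t $ 1 = p$1 + X t" "\<And>t. v t $ 2 = p$2 + Y t"
  shows "(\<lambda>t. Phi a b (v t) $ i) \<in> alg H"
proof -
  have H: "h \<in> alg H" if "h \<in> trig_gens X Y" for h
    using that assms(1) by (auto intro: alg.gen)
  have "\<forall>i. (\<lambda>t. Phi a b (v t) $ i) \<in> alg H"
    unfolding forall_8 Phi_nth assms(2,3) divide_inverse
    by (intro conjI alg.mult alg.const H trig_gens.intros)
  then show ?thesis ..
qed

context flat_surface
begin

text \<open>The second partial derivatives of \<open>K\<close> are \<open>- pair_xx\<close>,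
  \<open>- pair_xy\<close> and \<open>pair_yy\<close>.\<close>

definition pair_xx :: "real \<Rightarrow> real \<Rightarrow> real" where
  "pair_xx x y = (a\<^sup>2 * cos (a * x) * cosh (b * y) + b\<^sup>2 * cos (b * x) * cosh (a * y)) / 2"

definition pair_xy :: "real \<Rightarrow> real \<Rightarrow> real" where
  "pair_xy x y = a * b * (sin (a * x) * sinh (b * y) + sin (b * x) * sinh (a * y)) / 2"

definition pair_yy :: "real \<Rightarrow> real \<Rightarrow> real" where
  "pair_yy x y = (b\<^sup>2 * cos (a * x) * cosh (b * y) + a\<^sup>2 * cos (b * x) * cosh (a * y)) / 2"

lemmas pair_defs = pair_xx_def pair_xy_def pair_yy_def

lemma section_eq_has_derivative:
  assumes [derivative_intros]: "(X has_real_derivative X') (at t)" "(Y has_real_derivative Y') (at t)"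
  shows "((\<lambda>t. section_eq u (X t) (Y t)) has_real_derivative
    (u$2 * pair_xx (X t) (Y t) + u$1 * pair_xy (X t) (Y t)) * X' +
    (u$2 * pair_xy (X t) (Y t) - u$1 * pair_yy (X t) (Y t)) * Y') (at t)"
  unfolding section_eq_def pair_x_def pair_y_def pair_defs
  by (auto intro!: derivative_eq_intros simp: field_simps power2_eq_square)

lemma pair_0: "pair_xx 0 0 = 1" "pair_xy 0 0 = 0" "pair_yy 0 0 = 1"
  using ab_sum by (simp_all add: pair_defs)

lemma pair_alg:
  "(\<lambda>t. pair_xx (X t) (Y t)) \<in> alg (trig_gens X Y)"
  "(\<lambda>t. pair_xy (X t) (Y t)) \<in> alg (trig_gens X Y)"
  "(\<lambda>t. pair_yy (X t) (Y t)) \<in> alg (trig_gens X Y)"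
  unfolding pair_defs divide_inverse
  by (intro alg.add alg.mult alg.const alg.gen trig_gens_0)+

end

lemma metric_E21_conj_coords:
  "metric_E21 (\<sigma> *\<^sub>R u + \<omega> *\<^sub>R conj_vec u) (\<sigma>' *\<^sub>R u + \<omega>' *\<^sub>R conj_vec u) =
    (\<sigma> * \<sigma>' - \<omega> * \<omega>') * metric_E21 u u"
  "metric_E21 (\<sigma> *\<^sub>R u + \<omega> *\<^sub>R conj_vec u) u = \<sigma> * metric_E21 u u"
  "metric_E21 (\<sigma> *\<^sub>R u + \<omega> *\<^sub>R conj_vec u) (conj_vec u) = - \<omega> * metric_E21 u u"
  by (simp_all add: metric_E21_def algebra_simps)

lemma continuous_on_metric_E21: "continuous_on S (\<lambda>q. metric_E21 (q - p) u)"
  unfolding metric_E21_def by (intro continuous_intros)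

context flat_surface
begin

text \<open>The defining equation of the section, in the coordinates \<open>p + s u + w (conj_vec u)\<close> and normalized
  to have \<open>w\<close>-derivative 1 at the origin, with its partial derivatives.\<close>

definition sec :: "real^2 \<Rightarrow> real \<Rightarrow> real \<Rightarrow> real" where
  "sec u s w = - metric_E21 u u * section_eq u (s * u$1 + w * u$2) (s * u$2 + w * u$1)"

definition sec_s :: "real^2 \<Rightarrow> real \<Rightarrow> real \<Rightarrow> real" where
  "sec_s u s w = - metric_E21 u u *
    (let x = s * u$1 + w * u$2; y = s * u$2 + w * u$1 in
     (u$2 * pair_xx x y + u$1 * pair_xy x y) * u$1 + (u$2 * pair_xy x y - u$1 * pair_yy x y) * u$2)"

definition sec_w :: "real^2 \<Rightarrow> real \<Rightarrow> real \<Rightarrow> real" where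
  "sec_w u s w = - metric_E21 u u *
    (let x = s * u$1 + w * u$2; y = s * u$2 + w * u$1 in
     (u$2 * pair_xx x y + u$1 * pair_xy x y) * u$2 + (u$2 * pair_xy x y - u$1 * pair_yy x y) * u$1)"

lemma sec_derivs:
  "((\<lambda>s. sec u s w) has_real_derivative sec_s u s w) (at s)"
  "((\<lambda>w. sec u s w) has_real_derivative sec_w u s w) (at w)"
  unfolding sec_def sec_s_def sec_w_def Let_def
  by (intro DERIV_cmult section_eq_has_derivative; auto intro!: derivative_eq_intros)+

lemma sec_derivs_continuous:
  "continuous_on UNIV (\<lambda>(s, w). sec_s u s w)" "continuous_on UNIV (\<lambda>(s, w). sec_w u s w)"
  unfolding sec_s_def sec_w_def Let_def pair_defs case_prod_beta
  by (intro continuous_intros; simp)+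

text \<open>At the origin \<open>section_eq\<close> has derivative \<open>- metric_E21 u u\<close>
  along \<open>conj_vec u\<close> and 0 along \<open>u\<close>; the factor in \<open>sec\<close>
  turns the former into a square equal to 1.\<close>

lemma sec_at_0:
  assumes "\<bar>metric_E21 u u\<bar> = 1"
  shows "sec u 0 0 = 0" "sec_s u 0 0 = 0" "sec_w u 0 0 = 1"
proof -
  have "metric_E21 u u * metric_E21 u u = 1"
    using assms by (metis abs_mult_self_eq mult_1)
  then show "sec u 0 0 = 0" "sec_s u 0 0 = 0" "sec_w u 0 0 = 1"
    by (simp_all add: sec_def sec_s_def sec_w_def pair_0) (simp add: metric_E21_def algebra_simps)
qed

lemma sec_derivs_alg:
  assumes "trig_gens (\<lambda>t. s t * u$1 + w t * u$2) (\<lambda>t. s t * u$2 + w t * u$1) \<subseteq> H"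
  shows "(\<lambda>t. sec_s u (s t) (w t)) \<in> alg H" "(\<lambda>t. sec_w u (s t) (w t)) \<in> alg H"
  unfolding sec_s_def sec_w_def Let_def
  by (intro alg.add alg_diff alg.mult alg.const pair_alg[THEN alg_mono] assms)+

lemma contact_at_6:
  assumes u: "\<bar>metric_E21 u u\<bar> = 1" and "k \<le> 6"
  shows "contact_at metric_E21 metric_E84 (Phi a b) k p u"
proof -

  \<comment> \<open>The section as a unit speed curve in the parameter plane\<close>
  define e where "e = conj_vec u"
  have u0: "metric_E21 u u \<noteq> 0" using u by auto
  \<comment> \<open>If s and w are bounded by \<open>R\<close>, the first components of any two
    points differ by at most 1, as \<open>Phi_locally_inj\<close> requires.\<close>
  define R where "R = 1 / (2 * (1 + \<bar>u$1\<bar> + \<bar>u$2\<bar>))"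
  have "R > 0" by (simp add: R_def add_pos_nonneg)
  obtain r \<delta> s w where r: "0 < r" "r \<le> R" and \<delta>: "0 < \<delta>" and s0: "s 0 = 0" and w0: "w 0 = 0"
    and so: "open (s ` {-\<delta><..<\<delta>})"
    and bd: "\<And>t. \<bar>t\<bar> < \<delta> \<Longrightarrow> \<bar>s t\<bar> < r \<and> \<bar>w t\<bar> < r"
    and zero: "\<And>t \<omega>. \<bar>t\<bar> < \<delta> \<Longrightarrow> \<bar>\<omega>\<bar> < r \<Longrightarrow> sec u (s t) \<omega> = 0 \<longleftrightarrow> \<omega> = w t"
    and wb: "\<And>t. \<bar>t\<bar> < \<delta> \<Longrightarrow> \<bar>w t\<bar> \<le> 2 * \<bar>sec u (s t) 0\<bar>"
    and pos: "\<And>t. \<bar>t\<bar> < \<delta> \<Longrightarrow> 0 < sec_w u (s t) (w t) \<and> 2 * \<bar>sec_s u (s t) (w t)\<bar> \<le> sec_w u (s t) (w t)"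
    and sd: "\<And>t. \<bar>t\<bar> < \<delta> \<Longrightarrow> (s has_real_derivative
        sec_w u (s t) (w t) / sqrt ((sec_w u (s t) (w t))\<^sup>2 - (sec_s u (s t) (w t))\<^sup>2)) (at t)"
    and wd: "\<And>t. \<bar>t\<bar> < \<delta> \<Longrightarrow> (w has_real_derivative
        - sec_s u (s t) (w t) / sqrt ((sec_w u (s t) (w t))\<^sup>2 - (sec_s u (s t) (w t))\<^sup>2)) (at t)"
    by (rule unit_speed_zero_set[OF sec_derivs sec_derivs_continuous sec_at_0[OF u] \<open>R > 0\<close>]) (rule that)
  define I where "I = {-\<delta><..<\<delta>}"
  have I: "t \<in> I \<longleftrightarrow> \<bar>t\<bar> < \<delta>" for t by (auto simp: I_def)
  have oI: "open I" and 0: "0 \<in> I" using \<delta> by (auto simp: I_def)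
  \<comment> \<open>Squares, signs and the quotient are written as products, so that membership in
    \<open>alg\<close> follows the shape of the terms. \<open>S\<close> and \<open>W\<close> are the
    derivatives of \<open>s\<close> and \<open>w\<close>.\<close>
  define q where "q t = sec_w u (s t) (w t) * sec_w u (s t) (w t) - sec_s u (s t) (w t) * sec_s u (s t) (w t)" for t
  define l where "l t = 1 / sqrt (q t)" for t
  define S W where "S t = sec_w u (s t) (w t) * l t" and "W t = (- 1 * sec_s u (s t) (w t)) * l t" for t
  have qpos: "q t > 0" if "t \<in> I" for t
  proof -
    have "\<bar>sec_s u (s t) (w t)\<bar> * \<bar>sec_s u (s t) (w t)\<bar> < sec_w u (s t) (w t) * sec_w u (s t) (w t)"
      using pos[of t] that unfolding I by (intro mult_strict_mono') auto
    then show ?thesis by (simp add: q_def)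
  qed
  have sd': "(s has_real_derivative S t) (at t)" and wd': "(w has_real_derivative W t) (at t)" if "t \<in> I" for t
    using sd[of t] wd[of t] that unfolding I by (simp_all add: S_def W_def l_def q_def power2_eq_square)
  have S0: "S 0 = 1" and W0: "W 0 = 0"
    by (simp_all add: S_def W_def l_def q_def s0 w0 sec_at_0[OF u])
  have SW: "S t * S t - W t * W t = 1" "S t > 0" "2 * \<bar>W t\<bar> \<le> S t" if "t \<in> I" for t
  proof -
    have "S t * S t - W t * W t = q t * (l t * l t)"
      by (simp add: S_def W_def q_def algebra_simps)
    then show "S t * S t - W t * W t = 1"
      using qpos[OF that] by (simp add: l_def)
    have l: "l t > 0" using qpos[OF that] by (simp add: l_def)
    then show "S t > 0" using pos[of t] that unfolding I by (simp add: S_def)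
    have "(2 * \<bar>sec_s u (s t) (w t)\<bar>) * l t \<le> S t"
      unfolding S_def using pos[of t] that l unfolding I by (intro mult_right_mono) auto
    then show "2 * \<bar>W t\<bar> \<le> S t" using l by (simp add: W_def abs_mult)
  qed

  \<comment> \<open>Smoothness of the curve\<close>
  define X Y where "X t = s t * u$1 + w t * u$2" and "Y t = s t * u$2 + w t * u$1" for t
  \<comment> \<open>The inverse square root is the generator \<open>l\<close>; \<open>w\<close> is
    added so that it obtains a derivative sequence of its own.\<close>
  define H where "H = insert l (insert w (trig_gens X Y))"
  have tr: "trig_gens X Y \<subseteq> H" by (auto simp: H_def)
  have sub: "trig_gens (\<lambda>t. s t * u$1 + w t * u$2) (\<lambda>t. s t * u$2 + w t * u$1) \<subseteq> trig_gens X Y"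
    by (simp add: X_def[abs_def] Y_def[abs_def])
  note sa = sec_derivs_alg[OF sub]
  have lH: "l \<in> alg H" by (rule alg.gen) (simp add: H_def)
  have SWa: "S \<in> alg H" "W \<in> alg H"
    unfolding S_def[abs_def] W_def[abs_def]
    by (intro alg.mult alg.const lH sa[THEN alg_mono] tr)+
  have XYa: "(\<lambda>t. S t * u$1 + W t * u$2) \<in> alg H" "(\<lambda>t. S t * u$2 + W t * u$1) \<in> alg H"
    by (intro alg.add alg.mult alg.const SWa)+
  have XYd: "(X has_real_derivative S t * u$1 + W t * u$2) (at t)"
    "(Y has_real_derivative S t * u$2 + W t * u$1) (at t)" if "t \<in> I" for t
    unfolding X_def[abs_def] Y_def[abs_def]
    by (intro DERIV_add DERIV_cmult_right sd' wd' that)+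
  note trd = trig_gens_deriv[OF _ tr XYa XYd]
  \<comment> \<open>As \<open>q\<close> does not involve \<open>l\<close>, its derivative is
    available before \<open>H\<close> is known to be closed. The derivative of \<open>l\<close> is
    then the product - l^3 q' / 2.\<close>
  have "q \<in> alg (trig_gens X Y)"
    unfolding q_def[abs_def] by (intro alg_diff alg.mult sa)
  from alg_deriv[OF this tr trd] obtain q' where q': "q' \<in> alg H"
    "\<And>t. t \<in> I \<Longrightarrow> (q has_real_derivative q' t) (at t)" by blast
  have ld: "(l has_real_derivative - (1/2) * (l t * (l t * (l t * q' t)))) (at t)" if "t \<in> I" for t
    unfolding l_def[abs_def] using qpos[OF that]
    by (auto intro!: derivative_eq_intros q'(2)[OF that] simp: divide_simps)
  have clos: "\<exists>h\<in>alg H. \<forall>t\<in>I. (g has_real_derivative h t) (at t)" if "g \<in> H" for g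
  proof -
    consider "g = l" | "g = w" | "g \<in> trig_gens X Y" using \<open>g \<in> H\<close> by (auto simp: H_def)
    then show ?thesis
    proof cases
      case 1
      show ?thesis
      proof (rule bexI)
        show "\<forall>t\<in>I. (g has_real_derivative - (1/2) * (l t * (l t * (l t * q' t)))) (at t)"
          using ld 1 by blast
      qed (intro alg.mult alg.const lH q'(1))
    next
      case 2
      then show ?thesis using wd' SWa(2) by blast
    qed (rule trd)
  qed

  define v where "v t = p + (s t *\<^sub>R u + w t *\<^sub>R e)" for t
  define \<beta> where "\<beta> t = Phi a b (v t)" for t
  have v12: "v t $ 1 = p$1 + X t" "v t $ 2 = p$2 + Y t" for t
    by (simp_all add: v_def e_def X_def Y_def)
  obtain B where B: "deriv_seq I B" "B 0 = \<beta>"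
  proof (rule alg_deriv_seq_vec[OF clos])
    show "(\<lambda>t. \<beta> t $ i) \<in> alg H" for i
      unfolding \<beta>_def by (rule Phi_nth_alg[OF tr v12])
  qed
  obtain Dw where Dw: "deriv_seq I Dw" "Dw 0 = w"
    by (rule alg_deriv_seq[OF clos alg.gen[of w]]) (auto simp: H_def)

  \<comment> \<open>Seventh order estimates for w and s - t\<close>
  have flat_sec: "flat 7 (\<lambda>s. sec u s 0)"
  proof -
    obtain D where D: "deriv_seq UNIV D" "\<And>s. D 0 s = section_eq u (s * u$1) (s * u$2)"
      "\<And>r. r < 7 \<Longrightarrow> D r 0 = 0"
      "D 7 0 = u$1 * u$2 * ((u$1)\<^sup>2 + (u$2)\<^sup>2) * (((u$1)\<^sup>2 + (u$2)\<^sup>2)\<^sup>2 + 4 * (u$1)\<^sup>2 * (u$2)\<^sup>2)"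
      by (rule section_eq_line_deriv_seq[of u]) (rule that)
    have "flat 7 (D 0)"
      by (rule deriv_seq_zero_flat[OF deriv_seq_subset[OF D(1)], of 1]) (use D(3) in auto)
    then show ?thesis
      by (rule flat_dominated[where K = 1]) (simp_all add: sec_def D(2) abs_mult u)
  qed
  \<comment> \<open>From S^2 - W^2 = 1 and 4 W^2 <= S^2; it bounds \<open>s\<close> linearly, so
    orders in \<open>s t\<close> become orders in t.\<close>
  have S2: "S t \<le> 2" if "t \<in> I" for t
  proof (rule ccontr)
    assume "\<not> S t \<le> 2"
    moreover have "(2 * \<bar>W t\<bar>) * (2 * \<bar>W t\<bar>) \<le> S t * S t"
      using SW[OF that] by (intro mult_mono) auto
    moreover have "2 * 2 \<le> S t * S t"
      using \<open>\<not> S t \<le> 2\<close> by (intro mult_mono) auto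
    ultimately show False using SW(1)[OF that] by simp
  qed
  have sb: "\<bar>s t\<bar> \<le> 2 * \<bar>t\<bar>" if "t \<in> I" for t
  proof -
    have "norm (s t - s 0) \<le> 2 * norm (t - 0)"
    proof (rule field_differentiable_bound[where f' = S and S = I])
      show "convex I" by (simp add: I_def)
      show "(s has_field_derivative S z) (at z within I)" "norm (S z) \<le> 2" if "z \<in> I" for z
        using sd'[OF that] S2[OF that] SW(2)[OF that] by (auto intro: has_field_derivative_at_within)
    qed (use that 0 in auto)
    then show ?thesis by (simp add: s0)
  qed
  have evI: "\<forall>\<^sub>F t in nhds 0. t \<in> I"
    using eventually_abs_less[OF \<delta>] by (simp add: I)
  have flat_w: "flat 7 w"
  proof (rule flat_dominated)
    show "flat 7 (\<lambda>t. sec u (s t) 0)"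
      by (rule flat_compose_lipschitz[OF flat_sec, of _ 2], rule eventually_mono[OF evI]) (use sb in auto)
    show "\<forall>\<^sub>F t in nhds 0. norm (w t) \<le> 2 * norm (sec u (s t) 0)"
      by (rule eventually_mono[OF evI]) (use wb I in auto)
  qed simp
  have Dw0: "Dw r 0 = 0" if "r \<le> 6" for r
    by (rule flat_deriv_seq_zero[OF Dw(1)[unfolded I_def] \<delta> _ that]) (simp add: Dw(2) flat_w)
  have W_eq: "Dw (Suc 0) t = W t" if "t \<in> I" for t
    using DERIV_unique[OF _ wd'[OF that]] deriv_seqD[OF Dw(1) that, of 0]
    by (simp add: Dw(2) has_real_derivative_iff_has_vector_derivative)
  have flat_W: "flat 6 W"
  proof (rule flat_dominated)
    have "deriv_seq {-\<delta><..<\<delta>} (\<lambda>r. Dw (Suc r))"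
      using Dw(1) by (auto simp: deriv_seq_def I_def)
    from deriv_seq_zero_flat[OF this \<delta>, of 6] show "flat 6 (Dw (Suc 0))"
      using Dw0 by simp
    show "\<forall>\<^sub>F t in nhds 0. norm (W t) \<le> 1 * norm (Dw (Suc 0) t)"
      by (rule eventually_mono[OF evI]) (simp add: W_eq)
  qed simp
  \<comment> \<open>Since (S - 1) (S + 1) = W^2 and |W| <= S + 1, the deviation |S - 1| is at most
    |W|; integrating it regains order seven for s - t.\<close>
  have flat_S: "flat 6 (\<lambda>t. S t - 1)"
  proof (rule flat_dominated[OF flat_W])
    show "\<forall>\<^sub>F t in nhds 0. norm (S t - 1) \<le> 1 * norm (W t)"
    proof (rule eventually_mono[OF evI])
      fix t assume t: "t \<in> I"
      have eq: "(S t - 1) * (S t + 1) = \<bar>W t\<bar> * \<bar>W t\<bar>" using SW(1)[OF t] by (simp add: algebra_simps)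
      have "\<bar>S t - 1\<bar> * (S t + 1) = \<bar>W t\<bar> * \<bar>W t\<bar>"
        using arg_cong[OF eq, of abs] SW(2)[OF t] by (simp add: abs_mult)
      also have "\<dots> \<le> \<bar>W t\<bar> * (S t + 1)" using SW(2,3)[OF t] by (intro mult_left_mono) auto
      finally show "norm (S t - 1) \<le> 1 * norm (W t)" using SW(2)[OF t] by simp
    qed
  qed simp
  have flat_s: "flat 7 (\<lambda>t. s t - t)"
  proof -
    have "flat (Suc 6) (\<lambda>t. s t - t)"
    proof (rule flat_antiderivative[OF _ \<delta> _ flat_S])
      show "((\<lambda>t. s t - t) has_real_derivative S t - 1) (at t)" if "\<bar>t\<bar> < \<delta>" for t
        using sd'[of t] that I by (auto intro!: derivative_eq_intros)
    qed (simp add: s0)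
    then show ?thesis by simp
  qed

  \<comment> \<open>Agreement of the derivatives up to order six\<close>
  have vd: "(v has_vector_derivative S t *\<^sub>R u + W t *\<^sub>R e) (at t)" if "t \<in> I" for t
    using sd'[OF that] wd'[OF that] unfolding v_def[abs_def]
    by (auto intro!: derivative_eq_intros simp: has_real_derivative_iff_has_vector_derivative)
  have \<beta>d: "(\<beta> has_vector_derivative inf_gen a b (S t *\<^sub>R u + W t *\<^sub>R e) (\<beta> t)) (at t)" if "t \<in> I" for t
    unfolding \<beta>_def[abs_def] by (rule Phi_has_vector_derivative[OF vd[OF that]])

  have "flat 7 (\<lambda>t. (s t - t) *\<^sub>R u + w t *\<^sub>R e)"
    by (intro flat_add flat_scaleR flat_s flat_w)
  moreover have "(\<lambda>t. (s t - t) *\<^sub>R u + w t *\<^sub>R e) = (\<lambda>t. v t - (p + t *\<^sub>R u))"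
    by (simp add: v_def fun_eq_iff algebra_simps)
  ultimately have "flat 7 (\<lambda>t. v t - (p + t *\<^sub>R u))" by simp
  then have fl: "flat (Suc 6) (\<lambda>t. \<beta> t - Phi a b (p + t *\<^sub>R u))"
    unfolding \<beta>_def using flat_Phi[of 7 v "\<lambda>t. p + t *\<^sub>R u" p a b] has_vector_derivative_continuous[OF vd[OF 0]]
    by (simp add: v_def s0 w0)
  have jets: "nth_vector_derivative r (Phi a b \<circ> (\<lambda>t. p + t *\<^sub>R u)) 0 = nth_vector_derivative r \<beta> 0"
    if "r \<le> 6" for r
  proof -
    note L = Phi_line_deriv_seq[of u p]
    have "B r 0 - (inf_gen a b u ^^ r) (Phi a b (p + 0 *\<^sub>R u)) = 0"
      using flat_deriv_seq_zero[OF deriv_seq_diff[OF B(1) deriv_seq_subset[OF L subset_UNIV], unfolded I_def] \<delta> _ that]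
        fl by (simp add: B(2))
    moreover have "nth_vector_derivative r \<beta> 0 = B r 0"
      by (rule deriv_seq_nth_vector_derivative[OF B(1) oI _ 0]) (simp add: B(2))
    moreover have "nth_vector_derivative r (Phi a b \<circ> (\<lambda>t. p + t *\<^sub>R u)) 0 =
        (inf_gen a b u ^^ r) (Phi a b (p + 0 *\<^sub>R u))"
      by (rule deriv_seq_nth_vector_derivative[OF L open_UNIV _ UNIV_I]) simp
    ultimately show ?thesis by simp
  qed

  \<comment> \<open>The curve as the whole local intersection\<close>
  define \<sigma> \<omega> where "\<sigma> z = metric_E21 (z - p) u / metric_E21 u u"
    and "\<omega> z = - (metric_E21 (z - p) e / metric_E21 u u)" for z
  have coords: "z = p + (\<sigma> z *\<^sub>R u + \<omega> z *\<^sub>R e)" for z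
    using conj_vec_decomp[OF u0, of "z - p"] by (simp add: \<sigma>_def \<omega>_def e_def algebra_simps)
  have \<sigma>\<omega>: "\<sigma> (p + (x *\<^sub>R u + y *\<^sub>R e)) = x" "\<omega> (p + (x *\<^sub>R u + y *\<^sub>R e)) = y" for x y
    using u0 by (simp_all add: \<sigma>_def \<omega>_def e_def metric_E21_conj_coords)
  \<comment> \<open>Over each value \<open>s t\<close> the strip |\<omega>| < r meets the zero set
    only in \<open>w t\<close>. The intersection is therefore exactly the curve and, being
    connected, its own component.\<close>
  define U where "U = \<sigma> -` (s ` I) \<inter> \<omega> -` {-r<..<r}"
  have "open U"
    unfolding U_def
  proof (intro open_Int open_vimage)
    show "continuous_on UNIV \<sigma>" "continuous_on UNIV \<omega>"
      unfolding \<sigma>_def \<omega>_def using u0 by (intro continuous_intros continuous_on_metric_E21; simp)+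
  qed (use so I_def in auto)
  have vU: "v t \<in> U" if "t \<in> I" for t
    using that bd[of t] by (auto simp: U_def v_def \<sigma>\<omega> I abs_less_iff)
  have "p \<in> U" using vU[OF 0] by (simp add: v_def s0 w0)

  have in_section: "Phi a b z \<in> section_space metric_E84 (Phi a b) p u \<longleftrightarrow> sec u (\<sigma> z) (\<omega> z) = 0" for z
  proof -
    have "(z - p) $ i = (\<sigma> z *\<^sub>R u + \<omega> z *\<^sub>R e) $ i" for i
      using coords[of z] by (metis add_diff_cancel_left')
    from this[of 1] this[of 2] show ?thesis
      unfolding section_space_Phi_iff[OF u0] using u0 by (simp add: sec_def e_def)
  qed
  have img: "\<beta> ` I = Phi a b ` U \<inter> section_space metric_E84 (Phi a b) p u"
  proof (intro equalityI subsetI)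
    fix z assume "z \<in> \<beta> ` I"
    then obtain t where t: "t \<in> I" "z = Phi a b (v t)" by (auto simp: \<beta>_def)
    have "sec u (s t) (w t) = 0" using zero[of t "w t"] bd[of t] t I by auto
    then have "z \<in> section_space metric_E84 (Phi a b) p u"
      unfolding t(2) in_section by (simp add: v_def \<sigma>\<omega>)
    with vU[OF t(1)] t(2) show "z \<in> Phi a b ` U \<inter> section_space metric_E84 (Phi a b) p u" by blast
  next
    fix z assume "z \<in> Phi a b ` U \<inter> section_space metric_E84 (Phi a b) p u"
    then obtain y where y: "y \<in> U" "z = Phi a b y" "sec u (\<sigma> y) (\<omega> y) = 0"
      using in_section by blast
    then obtain t where t: "t \<in> I" "\<sigma> y = s t" by (auto simp: U_def)
    have "\<bar>\<omega> y\<bar> < r" using y by (auto simp: U_def)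
    then have "\<omega> y = w t" using zero[of t "\<omega> y"] t y I by auto
    then have "y = v t" using coords[of y] t by (simp add: v_def)
    with t y show "z \<in> \<beta> ` I" by (auto simp: \<beta>_def)
  qed
  have "connected (\<beta> ` I)"
  proof (rule connected_continuous_image)
    show "continuous_on I \<beta>"
      using has_vector_derivative_continuous[OF \<beta>d] by (auto intro: continuous_at_imp_continuous_on)
  qed (simp add: I_def)
  moreover have \<beta>0: "\<beta> 0 = Phi a b p" by (simp add: \<beta>_def v_def s0 w0)
  ultimately have comp: "connected_component_set (\<beta> ` I) (Phi a b p) = \<beta> ` I"
    using 0 connected_component_eq_self by (metis image_eqI)

  \<comment> \<open>Local embedding\<close>
  define K where "K = (\<lambda>(x, y). p + (x *\<^sub>R u + y *\<^sub>R e)) ` ({-r..r} \<times> {-r..r})"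
  have "compact K"
    unfolding K_def
    by (intro compact_continuous_image compact_Times compact_Icc) (auto simp: case_prod_beta intro!: continuous_intros)
  have inj: "inj_on (Phi a b) K"
  proof (rule inj_onI)
    fix z z' assume "z \<in> K" "z' \<in> K" and eq: "Phi a b z = Phi a b z'"
    have Kex: "\<exists>x y. \<bar>x\<bar> \<le> r \<and> \<bar>y\<bar> \<le> r \<and> z = p + (x *\<^sub>R u + y *\<^sub>R e)" if "z \<in> K" for z
    proof -
      from that obtain x y where "x \<in> {-r..r}" "y \<in> {-r..r}" "z = p + (x *\<^sub>R u + y *\<^sub>R e)"
        unfolding K_def by auto
      then show ?thesis by (intro exI[of _ x] exI[of _ y]) auto
    qed
    obtain x y x' y' where xy: "\<bar>x\<bar> \<le> r" "\<bar>y\<bar> \<le> r" "\<bar>x'\<bar> \<le> r" "\<bar>y'\<bar> \<le> r"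
      "z = p + (x *\<^sub>R u + y *\<^sub>R e)" "z' = p + (x' *\<^sub>R u + y' *\<^sub>R e)"
      using Kex[OF \<open>z \<in> K\<close>] Kex[OF \<open>z' \<in> K\<close>] by blast
    have "\<bar>z$1 - z'$1\<bar> = \<bar>(x - x') * u$1 + (y - y') * u$2\<bar>"
      by (simp add: xy e_def algebra_simps)
    also have "\<dots> \<le> \<bar>x - x'\<bar> * \<bar>u$1\<bar> + \<bar>y - y'\<bar> * \<bar>u$2\<bar>"
      by (metis abs_mult abs_triangle_ineq)
    also have "\<dots> \<le> (2 * R) * \<bar>u$1\<bar> + (2 * R) * \<bar>u$2\<bar>"
      using xy r by (intro add_mono mult_right_mono) auto
    also have "\<dots> \<le> (2 * R) * (1 + \<bar>u$1\<bar> + \<bar>u$2\<bar>)"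
      using \<open>R > 0\<close> by (simp add: algebra_simps)
    also have "\<dots> = 1"
      unfolding R_def using add_pos_nonneg[of 1 "\<bar>u$1\<bar> + \<bar>u$2\<bar>"] by (simp add: field_simps)
    finally show "z = z'" by (rule Phi_locally_inj[OF eq])
  qed
  have "U \<subseteq> K"
  proof
    fix z assume z: "z \<in> U"
    then obtain t where "t \<in> I" "\<sigma> z = s t" "\<bar>\<omega> z\<bar> < r" by (auto simp: U_def)
    then have "(\<sigma> z, \<omega> z) \<in> {-r..r} \<times> {-r..r}" using bd[of t] I by auto
    then show "z \<in> K" unfolding K_def using coords[of z] by (intro image_eqI[of _ _ "(\<sigma> z, \<omega> z)"]) auto
  qed
  \<comment> \<open>A continuous injection of a compact set is a homeomorphism onto its image; it
    restricts to the open set \<open>U\<close>.\<close>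
  obtain \<phi> where "homeomorphism K (Phi a b ` K) (Phi a b) \<phi>"
    using homeomorphism_compact[OF \<open>compact K\<close> continuous_on_Phi refl inj] by blast
  then have hom: "homeomorphism U (Phi a b ` U) (Phi a b) \<phi>"
    by (rule homeomorphism_of_subsets) (use \<open>U \<subseteq> K\<close> in auto)

  \<comment> \<open>The normal section and its contact with the geodesic\<close>
  have ns: "normal_section metric_E21 metric_E84 (Phi a b) p u \<beta>"
    unfolding normal_section_def I_def[symmetric] frechet_derivative_Phi
  proof (intro exI[of _ U] exI[of _ \<delta>] exI[of _ \<phi>] conjI ballI)
    show "smooth_curve_on {-\<delta><..<\<delta>} \<beta>"
      unfolding I_def[symmetric] smooth_curve_on_iff_deriv_seq[OF oI] using B by auto
    show "\<beta> ` {-\<delta><..<\<delta>} = connected_component_set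
        (Phi a b ` U \<inter> section_space metric_E84 (Phi a b) p u) (Phi a b p)"
      unfolding I_def[symmetric] img[symmetric] comp ..
    show "metric_E84 (vector_derivative \<beta> (at t)) (vector_derivative \<beta> (at t)) = metric_E21 u u"
      if "t \<in> {-\<delta><..<\<delta>}" for t
    proof -
      have t: "t \<in> I" using that by (simp add: I_def)
      show ?thesis
        unfolding vector_derivative_at[OF \<beta>d[OF t]] \<beta>_def metric_inf_gen_inf_gen e_def metric_E21_conj_coords
        using SW(1)[OF t] by simp
    qed
    show "vector_derivative \<beta> (at 0) = inf_gen a b u (Phi a b p)"
      unfolding vector_derivative_at[OF \<beta>d[OF 0]] \<beta>0 by (simp add: S0 W0)
  qed (use \<open>open U\<close> \<open>p \<in> U\<close> hom \<delta> \<beta>0 in auto)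
  have d0: "vector_derivative (\<lambda>t. p + t *\<^sub>R u) (at 0) = u"
    by (rule vector_derivative_at) (auto intro!: derivative_eq_intros)
  show ?thesis
    unfolding contact_at_def
    by (rule exI[of _ "\<lambda>t. p + t *\<^sub>R u"], rule exI[of _ \<beta>])
      (use geodesic_line d0 ns jets \<open>k \<le> 6\<close> in auto)
qed

lemma spacelike_contact_iff: "spacelike_contact metric_E21 metric_E84 (Phi a b) k \<longleftrightarrow> k \<le> 6"
proof
  assume c: "spacelike_contact metric_E21 metric_E84 (Phi a b) k"
  \<comment> \<open>A unit spacelike vector with both components nonzero, because the seventh order
    coefficient contains the factor \<open>u$1 * u$2\<close>.\<close>
  define u :: "real^2" where "u = vector [sqrt 2, 1]"
  have u: "metric_E21 u u = 1" by (simp add: u_def metric_E21_def)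
  then have "contact_at metric_E21 metric_E84 (Phi a b) k 0 u"
    using c by (simp add: spacelike_contact_def)
  then show "k \<le> 6"
    using not_contact_at_7[of u k 0] u by (force simp: u_def)
qed (auto simp: spacelike_contact_def intro: contact_at_6)

lemma timelike_contact_iff: "timelike_contact metric_E21 metric_E84 (Phi a b) k \<longleftrightarrow> k \<le> 6"
proof
  assume c: "timelike_contact metric_E21 metric_E84 (Phi a b) k"
  \<comment> \<open>The timelike counterpart, again off the coordinate axes.\<close>
  define u :: "real^2" where "u = vector [1, sqrt 2]"
  have u: "metric_E21 u u = -1" by (simp add: u_def metric_E21_def)
  then have "contact_at metric_E21 metric_E84 (Phi a b) k 0 u"
    using c by (simp add: timelike_contact_def)
  then show "k \<le> 6"
    using not_contact_at_7[of u k 0] u by (force simp: u_def)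
qed (auto simp: timelike_contact_def intro: contact_at_6)

lemma contact_iff: "contact metric_E21 metric_E84 (Phi a b) k \<longleftrightarrow> k \<le> 6"
  by (simp add: contact_def spacelike_contact_iff timelike_contact_iff)

end

lemma Sup_enat_atMost: "Sup {enat k | k. k \<le> n} = enat n"
  by (rule antisym) (auto intro: Sup_least Sup_upper)

theorem mainTheorem3:
  fixes a b :: real
  assumes "a = sqrt (1 + 1 / sqrt 2)"
    and "b = sqrt (1 - 1 / sqrt 2)"
  shows "isometric_immersion metric_E21 metric_E84 (Phi a b) \<and>
         contact_number metric_E21 metric_E84 (Phi a b) = 6 \<and>
         spacelike_contact_number metric_E21 metric_E84 (Phi a b) = 6 \<and>
         timelike_contact_number metric_E21 metric_E84 (Phi a b) = 6"
proof -
  \<comment> \<open>This keeps the radicand of \<open>b\<close> positive, so that squaring undoes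
    the root and b > 0.\<close>
  have "1 / sqrt 2 < (1::real)" by simp
  moreover have "0 < 1 / sqrt 2" by simp
  ultimately have a2: "a\<^sup>2 = 1 + 1 / sqrt 2" and b2: "b\<^sup>2 = 1 - 1 / sqrt 2" and "0 < a" "0 < b"
    unfolding assms by (simp_all add: add_pos_pos)
  interpret flat_surface a b
  proof
    show "a\<^sup>2 + b\<^sup>2 = 2" by (simp add: a2 b2)
    show "a\<^sup>2 * b\<^sup>2 = 1 / 2" by (simp add: a2 b2 algebra_simps)
  qed fact+
  show ?thesis
    using isometric_immersion_Phi Sup_enat_atMost[of 6]
    by (simp add: contact_number_def spacelike_contact_number_def timelike_contact_number_def
        contact_iff spacelike_contact_iff timelike_contact_iff numeral_eq_enat)
qed

end
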